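(* Let $G\in\mathfrak{R}H^\infty_{m\times p}$ and $K\in\mathfrak{R}H^\infty_{m\times q}$ be given by the minimal realization \[ \begin{bmatrix} G(z) & K(z)\end{bmatrix}=\begin{bmatrix} D_1 & D_2\end{bmatrix}+zC(I_n-zA)^{-1}\begin{bmatrix} B_1 & B_2\end{bmatrix}, \] with $A$ a stable $n\times n$ matrix. Let $F\in\mathfrak{R}H^\infty_{m\times r}$ be a function of the form $F(z)=D_3+zC(I_n-zA)^{-1}B_3$ such that $T_GT_G^*-T_KT_K^*-T_FT_F^*=W_{obs}(P_3+P_2-P_1)W_{obs}^*$ and $P_3+P_2-P_1\ge 0$, where $P_3$ is the controllability Gramian of $\{A,B_3\}$. Let $Y=\sum_{\nu\ge0}(A^* )^\nu C^*CA^\nu$ (the solution of $Y=A^*YA+C^*C$), set $\Upsilon=(P_3+P_2-P_1)^{1/2}$, and let \[ U=\begin{bmatrix}\alpha&\beta_1&\beta_2\\ \gamma&\delta_1&\delta_2\end{bmatrix}:\mathbb{C}^n\oplus\mathbb{C}^q\oplus\mathbb{C}^r\to\mathbb{C}^n\oplus\mathbb{C}^p \] be defined by \[ U=\begin{bmatrix}\Upsilon Y\Upsilon & \Upsilon YB_1\\ B_1^*Y\Upsilon & D_1^*D_1+B_1^*YB_1\end{bmatrix}^{+} \begin{bmatrix}\Upsilon YA\Upsilon & \Upsilon YB_2 & \Upsilon YB_3\\ D_1^*C\Upsilon+B_1^*YA\Upsilon & D_1^*D_2+B_1^*YB_2 & D_1^*D_3+B_1^*YB_3\end{bmatrix}, \]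 where ${}^+$ denotes the Moore--Penrose generalized inverse. Then $U$ is a partial isometry and: (i) the function $X(z)=\delta_1+z\gamma(I-z\alpha)^{-1}\beta_1$ is a $p\times q$ stable rational matrix function satisfying $G(z)X(z)=K(z)$ for $z\in\mathbb{D}$ and $\sup_{z\in\mathbb{D}}\|X(z)\|\le 1$; (ii) the function $\Psi(z)=\delta_2+z\gamma(I-z\alpha)^{-1}\beta_2$ is a $p\times r$ stable rational matrix function with $\sup_{z\in\mathbb{D}}\|\Psi(z)\|\le1$ and $G(z)\Psi(z)=F(z)$.
   Context: $\mathfrak{R}H^\infty_{k\times l}$ denotes the $k\times l$ rational matrix functions with no poles in the closed unit disc; $\mathbb{D}$ is the open unit disc. A square matrix is stable if all eigenvalues lie in $\mathbb{D}$. A realization is minimal if it has the smallest possible state dimension (equivalently, it is observable and controllable). $\ell^2_+(\mathbb{C}^k)$ is the space of square summable $\mathbb{C}^k$-valued sequences indexed by $j\ge0$; for a matrix $H^\infty$ function $\Omega$ with Taylor coefficients $\Omega_j$, $T_\Omega$ is the block lower triangular Toeplitz operator with $(i,j)$ block $\Omega_{i-j}$ (zero if $i<j$). $W_{obs}=\operatorname{col}(CA^j)_{j\ge0}:\mathbb{C}^n\to\ell^2_+(\mathbb{C}^m)$. For $j=1,2,3$, $P_j=\sum_{\nu\ge0}A^\nu B_jB_j^*(A^* )^\nu$. The Moore--Penrose inverse $T^+$ of a matrix $T$ is the unique matrix with $T^+T$ and $TT^+$ the orthogonal projections onto $\operatorname{Im}T^*$ and $\operatorname{Im}T$, respectively.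 *)

theory Defs
  imports "HOL-Analysis.Analysis" "Jordan_Normal_Form.Char_Poly"
begin

definition hadj :: "complex mat \<Rightarrow> complex mat" where
  "hadj M = transpose_mat (map_mat cnj M)"

(* Inverse of a square matrix (used only where it exists) *)
definition minv :: "complex mat \<Rightarrow> complex mat" where
  "minv M = (THE N. N \<in> carrier_mat (dim_row M) (dim_row M) \<and>
              N * M = 1\<^sub>m (dim_row M) \<and> M * N = 1\<^sub>m (dim_row M))"

definition stable_mat :: "complex mat \<Rightarrow> bool" where
  "stable_mat A = (\<forall>ev. eigenvalue A ev \<longrightarrow> cmod ev < 1)"

definition tf :: "complex mat \<Rightarrow> complex mat \<Rightarrow> complex mat \<Rightarrow> complex mat \<Rightarrow> complex \<Rightarrow> complex mat" where
  "tf D C A B z = D + z \<cdot>\<^sub>m (C * minv (1\<^sub>m (dim_row A) - z \<cdot>\<^sub>m A) * B)"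

definition observable :: "complex mat \<Rightarrow> complex mat \<Rightarrow> bool" where
  "observable C A = (\<forall>x \<in> carrier_vec (dim_row A).
      (\<forall>j < dim_row A. (C * A ^\<^sub>m j) *\<^sub>v x = 0\<^sub>v (dim_row C)) \<longrightarrow> x = 0\<^sub>v (dim_row A))"

definition controllable :: "complex mat \<Rightarrow> complex mat \<Rightarrow> bool" where
  "controllable A B = observable (hadj B) (hadj A)"

definition minimal_realization :: "complex mat \<Rightarrow> complex mat \<Rightarrow> complex mat \<Rightarrow> bool" where
  "minimal_realization C A B = (observable C A \<and> controllable A B)"

definition hcat :: "complex mat \<Rightarrow> complex mat \<Rightarrow> complex mat" where
  "hcat X Y = four_block_mat X Y (0\<^sub>m 0 (dim_col X)) (0\<^sub>m 0 (dim_col Y))"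

definition blk :: "complex mat \<Rightarrow> nat \<Rightarrow> nat \<Rightarrow> nat \<Rightarrow> nat \<Rightarrow> complex mat" where
  "blk U r0 c0 nr nc = mat nr nc (\<lambda>(i,j). U $$ (i + r0, j + c0))"

definition msuminf :: "nat \<Rightarrow> nat \<Rightarrow> (nat \<Rightarrow> complex mat) \<Rightarrow> complex mat" where
  "msuminf k l S = mat k l (\<lambda>(i,j). (\<Sum>\<nu>. S \<nu> $$ (i,j)))"

definition ctrl_gram :: "complex mat \<Rightarrow> complex mat \<Rightarrow> complex mat" where
  "ctrl_gram A B = msuminf (dim_row A) (dim_row A)
      (\<lambda>\<nu>. A ^\<^sub>m \<nu> * B * hadj B * hadj A ^\<^sub>m \<nu>)"

definition obs_gram :: "complex mat \<Rightarrow> complex mat \<Rightarrow> complex mat" where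
  "obs_gram C A = msuminf (dim_row A) (dim_row A)
      (\<lambda>\<nu>. hadj A ^\<^sub>m \<nu> * hadj C * C * A ^\<^sub>m \<nu>)"

definition psd :: "complex mat \<Rightarrow> bool" where
  "psd M = (M \<in> carrier_mat (dim_row M) (dim_row M) \<and> hadj M = M \<and>
     (\<forall>v \<in> carrier_vec (dim_row M). 0 \<le> Re (\<Sum>i<dim_vec v. cnj (v $ i) * (M *\<^sub>v v) $ i)))"

definition psd_sqrt :: "complex mat \<Rightarrow> complex mat" where
  "psd_sqrt M = (THE S. psd S \<and> dim_row S = dim_row M \<and> S * S = M)"

definition mp_inv :: "complex mat \<Rightarrow> complex mat" where
  "mp_inv T = (THE S. S \<in> carrier_mat (dim_col T) (dim_row T) \<and>
     T * S * T = T \<and> S * T * S = S \<and> hadj (T * S) = T * S \<and> hadj (S * T) = S * T)"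

definition partial_isometry :: "complex mat \<Rightarrow> bool" where
  "partial_isometry U = (hadj U * U * (hadj U * U) = hadj U * U)"

definition vnorm :: "complex vec \<Rightarrow> real" where
  "vnorm v = sqrt (\<Sum>i<dim_vec v. (cmod (v $ i))\<^sup>2)"

definition op_norm :: "complex mat \<Rightarrow> real" where
  "op_norm M = Sup {vnorm (M *\<^sub>v v) | v. v \<in> carrier_vec (dim_col M) \<and> vnorm v \<le> 1}"

definition taylor_coeff :: "nat \<Rightarrow> nat \<Rightarrow> (complex \<Rightarrow> complex mat) \<Rightarrow> nat \<Rightarrow> complex mat" where
  "taylor_coeff k l f j = mat k l (\<lambda>(a,b). (deriv ^^ j) (\<lambda>z. f z $$ (a,b)) 0 / of_nat (fact j))"

(* (i,j) block (k x k) of T_f T_g^H, where T_f, T_g are the block lower triangular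
   Toeplitz operators with coefficients f_0, f_1, ... and g_0, g_1, ... *)
definition toeplitz_prod_block :: "(nat \<Rightarrow> complex mat) \<Rightarrow> (nat \<Rightarrow> complex mat) \<Rightarrow> nat \<Rightarrow> nat \<Rightarrow> complex mat" where
  "toeplitz_prod_block f g i j =
     foldr (\<lambda>k acc. f (i - k) * hadj (g (j - k)) + acc) [0..<Suc (min i j)]
       (0\<^sub>m (dim_row (f 0)) (dim_row (g 0)))"

(* Stable rational matrix function: the given (realization) formula, valid where
   I - z alpha is invertible, agrees with a k x l matrix function analytic on an open
   neighbourhood of the closed unit disc (rationality is automatic from the formula) *)
definition stable_extension :: "nat \<Rightarrow> nat \<Rightarrow> (complex \<Rightarrow> complex mat) \<Rightarrow> complex mat \<Rightarrow> (complex \<Rightarrow> complex mat) \<Rightarrow> bool" where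
  "stable_extension k l Xt \<alpha> X =
     ((\<forall>z. Xt z \<in> carrier_mat k l) \<and>
      (\<exists>S. open S \<and> cball 0 1 \<subseteq> S \<and> (\<forall>a<k. \<forall>b<l. (\<lambda>z. Xt z $$ (a,b)) holomorphic_on S)) \<and>
      (\<forall>z. det (1\<^sub>m (dim_row \<alpha>) - z \<cdot>\<^sub>m \<alpha>) \<noteq> 0 \<longrightarrow> Xt z = X z))"

end

theory Submission
  imports Defs "Jordan_Normal_Form.Spectral_Radius"
begin

text \<open>
  Put \<open>Q = P3 + P2 - P1\<close>, \<open>\<Upsilon> = Q\<^bsup>1/2\<^esup>\<close>, and
  \<open>M = [\<Upsilon>, B1; 0, D1]\<close>, \<open>N = [A \<Upsilon>, B2, B3; C \<Upsilon>, D2, D3]\<close>, \<open>W = diag(Y, I)\<close>.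
  The first block column of the Toeplitz identity, cancelled by observability, together with the Stein
  equations of the Gramians, says exactly that \<open>N N\<^sup>* = M M\<^sup>*\<close>. Since \<open>W\<close> is positive definite, the
  matrix \<open>U = (M\<^sup>* W M)\<^sup>+ M\<^sup>* W N\<close> of the theorem is the unique solution of \<open>M U = N\<close> with range
  orthogonal to the kernel of \<open>M\<close>; it satisfies \<open>U U\<^sup>* = (M\<^sup>* W M)\<^sup>+ (M\<^sup>* W M)\<close> and is therefore a
  partial isometry. The block rows of \<open>M U = N\<close> give \<open>G X = K\<close> and \<open>G \<Psi> = F\<close> by a resolvent identity,
  and contractivity of \<open>U\<close> gives \<open>\<parallel>X(z)\<parallel> \<le> 1\<close> and \<open>\<parallel>\<Psi>(z)\<parallel> \<le> 1\<close> on the open disc. The matrix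
  \<open>\<alpha>\<close> may have eigenvalues on the unit circle, but a rational function that is bounded on the disc has
  no poles on its boundary: every zero of the denominator there cancels.
\<close>

subsection \<open>Matrix algebra and the adjoint\<close>

text \<open>\<open>M\<close>, \<open>N\<close> and \<open>W\<close> are shadows of maps into
  sequence space. Let \<Gamma> send (x, y) to the sequence y, C x, C A x, and so on. Then \<Gamma>
  \<open>M\<close> consists of \<open>W_obs\<close> \<Upsilon> shifted forward by one place, next to
  the first block column of T_G. The sequence starting with C \<Upsilon> and continued by C A
  \<Upsilon> is \<open>W_obs\<close> \<Upsilon> itself, so \<Gamma> \<open>N\<close> consists of
  \<open>W_obs\<close> \<Upsilon> and the first block columns of T_K and T_F. Finally, \<Gamma>
  followed by its adjoint is \<open>W\<close>. Subtracting from the Toeplitz identity its copy moved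
  one block down and to the right leaves only first block columns times their adjoints; sorted by
  sign, it says that \<Gamma> \<open>N\<close> and \<Gamma> \<open>M\<close> have the same product
  with their adjoints. Observability makes \<Gamma> injective: this is why \<Gamma> can be stripped
  off and why \<open>W\<close> is definite. Solvability of \<open>M U = N\<close> is not evident
  when \<Upsilon> is singular. It follows from the same equality, because the range of a matrix is
  determined by its product with its adjoint. The kernel that \<open>M\<close> may have is the
  reason for a pseudo-inverse.\<close>

no_notation Finite_Cartesian_Product.vec.vec_nth (infixl \<open>$\<close> 90)
no_notation Inner_Product.real_inner_class.inner (infix \<open>\<bullet>\<close> 70)

declare assoc_mult_mat [simp del] assoc_mult_mat_vec [simp del]

text \<open>The premises are equations between dimensions, because the inner dimensions in carrier
  premises are not determined by the term to be rewritten, whereas these equations are closed by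
  rewriting once all dimensions are known. The other \<open>_dims\<close> laws have this form for
  the same reason.\<close>

lemma mult_assoc_dims:
  fixes A B C :: "complex mat"
  assumes "dim_col A = dim_row B" "dim_col B = dim_row C"
  shows "A * B * C = A * (B * C)"
  by (rule assoc_mult_mat[of _ "dim_row A" "dim_col A" _ "dim_col B" _ "dim_col C"])
    (use assms in \<open>auto intro: carrier_matI\<close>)

lemma mult_mat_vec_assoc_dims:
  fixes A B :: "complex mat"
  assumes "dim_col A = dim_row B" "dim_col B = dim_vec v"
  shows "A * B *\<^sub>v v = A *\<^sub>v (B *\<^sub>v v)"
  by (rule assoc_mult_mat_vec[of _ "dim_row A" "dim_col A" _ "dim_col B"])
    (use assms in \<open>auto intro: carrier_matI carrier_vecI\<close>)

lemma mult_add_distrib_dims: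
  fixes A B C :: "complex mat"
  assumes "dim_col A = dim_row B" "dim_row B = dim_row C" "dim_col B = dim_col C"
  shows "A * (B + C) = A * B + A * C"
  by (rule mult_add_distrib_mat[of _ "dim_row A" "dim_col A" _ "dim_col B"])
    (use assms in \<open>auto intro: carrier_matI\<close>)

lemma add_mult_distrib_dims:
  fixes A B C :: "complex mat"
  assumes "dim_row A = dim_row B" "dim_col A = dim_col B" "dim_col B = dim_row C"
  shows "(A + B) * C = A * C + B * C"
  by (rule add_mult_distrib_mat[of _ "dim_row A" "dim_col A" _ _ "dim_col C"])
    (use assms in \<open>auto intro: carrier_matI\<close>)

lemma mult_minus_distrib_dims:
  fixes A B C :: "complex mat"
  assumes "dim_col A = dim_row B" "dim_row B = dim_row C" "dim_col B = dim_col C"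
  shows "A * (B - C) = A * B - A * C"
  by (rule mult_minus_distrib_mat[of _ "dim_row A" "dim_col A" _ "dim_col B"])
    (use assms in \<open>auto intro: carrier_matI\<close>)

lemma minus_mult_distrib_dims:
  fixes A B C :: "complex mat"
  assumes "dim_row A = dim_row B" "dim_col A = dim_col B" "dim_col B = dim_row C"
  shows "(A - B) * C = A * C - B * C"
  by (rule minus_mult_distrib_mat[of _ "dim_row A" "dim_col A" _ _ "dim_col C"])
    (use assms in \<open>auto intro: carrier_matI\<close>)

lemma mult_smult_dims:
  fixes A B :: "complex mat"
  assumes "dim_col A = dim_row B"
  shows "A * (k \<cdot>\<^sub>m B) = k \<cdot>\<^sub>m (A * B)"
  by (rule mult_smult_distrib[of _ "dim_row A" "dim_col A" _ "dim_col B"])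
    (use assms in \<open>auto intro: carrier_matI\<close>)

lemma smult_mult_dims:
  fixes A B :: "complex mat"
  assumes "dim_col A = dim_row B"
  shows "(k \<cdot>\<^sub>m A) * B = k \<cdot>\<^sub>m (A * B)"
  by (rule mult_smult_assoc_mat[of _ "dim_row A" "dim_col A" _ "dim_col B"])
    (use assms in \<open>auto intro: carrier_matI\<close>)

lemma smult_mult_mat_vec_dims:
  fixes A :: "complex mat"
  assumes "dim_col A = dim_vec v"
  shows "(k \<cdot>\<^sub>m A) *\<^sub>v v = k \<cdot>\<^sub>v (A *\<^sub>v v)"
  using assms by (auto simp: scalar_prod_def sum_distrib_left algebra_simps)

lemma mult_mat_smult_vec_dims:
  fixes A :: "complex mat"
  assumes "dim_col A = dim_vec v"
  shows "A *\<^sub>v (k \<cdot>\<^sub>v v) = k \<cdot>\<^sub>v (A *\<^sub>v v)"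
  using assms by (auto simp: scalar_prod_def sum_distrib_left algebra_simps)

lemma minus_mult_mat_vec_dims:
  fixes A B :: "complex mat"
  assumes "dim_row A = dim_row B" "dim_col A = dim_col B" "dim_col B = dim_vec v"
  shows "(A - B) *\<^sub>v v = A *\<^sub>v v - B *\<^sub>v v"
  using assms by (auto simp: scalar_prod_def sum_subtractf algebra_simps)

lemma add_mult_mat_vec_dims:
  fixes A B :: "complex mat"
  assumes "dim_row A = dim_row B" "dim_col A = dim_col B" "dim_col B = dim_vec v"
  shows "(A + B) *\<^sub>v v = A *\<^sub>v v + B *\<^sub>v v"
  using assms by (auto simp: scalar_prod_def sum.distrib algebra_simps)

lemma zero_add_mat_dims [simp]:
  fixes X :: "complex mat"
  assumes "dim_row X = a" "dim_col X = b"
  shows "0\<^sub>m a b + X = X" "X + 0\<^sub>m a b = X"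
  using assms by (auto intro!: eq_matI)

lemma minus_self_mat [simp]: "(A :: complex mat) - A = 0\<^sub>m (dim_row A) (dim_col A)"
  by (rule eq_matI) auto

lemma eq_mat_of_minus_eq_zero:
  fixes A B :: "complex mat"
  assumes "A - B = 0\<^sub>m a b" "A \<in> carrier_mat a b" "B \<in> carrier_mat a b"
  shows "A = B"
proof (rule eq_matI)
  fix i j assume "i < dim_row B" "j < dim_col B"
  then show "A $$ (i,j) = B $$ (i,j)"
    using assms(2,3) arg_cong[OF assms(1), of "\<lambda>M. M $$ (i,j)"] by simp
qed (use assms in auto)

lemma dim_row_hadj [simp]: "dim_row (hadj M) = dim_col M"
  and dim_col_hadj [simp]: "dim_col (hadj M) = dim_row M"
  by (simp_all add: hadj_def)

lemma hadj_carrier [simp]: "hadj M \<in> carrier_mat a b \<longleftrightarrow> M \<in> carrier_mat b a"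
  unfolding carrier_mat_def by auto

lemma index_hadj [simp]:
  "i < dim_col M \<Longrightarrow> j < dim_row M \<Longrightarrow> hadj M $$ (i,j) = cnj (M $$ (j,i))"
  by (simp add: hadj_def)

lemma hadj_hadj [simp]: "hadj (hadj M) = M"
  by (rule eq_matI) auto

lemma hadj_mult:
  assumes "dim_col M = dim_row N"
  shows "hadj (M * N) = hadj N * hadj M"
  by (rule eq_matI) (use assms in \<open>auto simp: scalar_prod_def mult.commute\<close>)

lemma hadj_add:
  assumes "dim_row M = dim_row N" "dim_col M = dim_col N"
  shows "hadj (M + N) = hadj M + hadj N"
  by (rule eq_matI) (use assms in auto)

lemma hadj_minus:
  assumes "dim_row M = dim_row N" "dim_col M = dim_col N"
  shows "hadj (M - N) = hadj M - hadj N"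
  by (rule eq_matI) (use assms in auto)

lemma hadj_one [simp]: "hadj (1\<^sub>m n) = 1\<^sub>m n"
  by (rule eq_matI) auto

lemma hadj_zero [simp]: "hadj (0\<^sub>m a b) = 0\<^sub>m b a"
  by (rule eq_matI) auto

lemma hadj_four_block_mat:
  assumes "A \<in> carrier_mat a c" "B \<in> carrier_mat a d" "C \<in> carrier_mat b c" "D \<in> carrier_mat b d"
  shows "hadj (four_block_mat A B C D) = four_block_mat (hadj A) (hadj C) (hadj B) (hadj D)"
  by (rule eq_matI) (use assms in auto)

lemma pow_mat_Suc_left:
  assumes "A \<in> carrier_mat n n"
  shows "(A :: complex mat) ^\<^sub>m Suc k = A * A ^\<^sub>m k"
proof (induction k)
  case (Suc k)
  have "A ^\<^sub>m Suc (Suc k) = (A * A ^\<^sub>m k) * A" using Suc by simp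
  also have "\<dots> = A * A ^\<^sub>m Suc k"
    using assms by (simp add: mult_assoc_dims)
  finally show ?case .
qed (use assms in simp)

lemma hadj_pow:
  assumes "A \<in> carrier_mat n n"
  shows "hadj (A ^\<^sub>m k) = hadj A ^\<^sub>m k"
proof (induction k)
  case 0 then show ?case using assms by simp
next
  case (Suc k)
  have "hadj (A ^\<^sub>m Suc k) = hadj A * hadj A ^\<^sub>m k"
    using assms Suc by (simp add: hadj_mult)
  then show ?case using assms by (subst pow_mat_Suc_left[of _ n]) auto
qed

section \<open>Inner product and Euclidean norm of complex vectors\<close>

definition ip :: "complex vec \<Rightarrow> complex vec \<Rightarrow> complex" where
  "ip u v = (\<Sum>i<dim_vec u. cnj (u $ i) * v $ i)"

lemma ip_hadj:
  assumes "dim_vec u = dim_row M" "dim_vec v = dim_col M"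
  shows "ip (hadj M *\<^sub>v u) v = ip u (M *\<^sub>v v)"
proof -
  have "ip (hadj M *\<^sub>v u) v = (\<Sum>i<dim_col M. \<Sum>k<dim_row M. M $$ (k,i) * cnj (u $ k) * v $ i)"
    using assms by (auto simp: ip_def scalar_prod_def sum_distrib_right atLeast0LessThan intro!: sum.cong)
  also have "\<dots> = (\<Sum>k<dim_row M. \<Sum>i<dim_col M. M $$ (k,i) * cnj (u $ k) * v $ i)"
    by (rule sum.swap)
  also have "\<dots> = ip u (M *\<^sub>v v)"
    using assms by (auto simp: ip_def scalar_prod_def sum_distrib_left atLeast0LessThan algebra_simps intro!: sum.cong)
  finally show ?thesis .
qed

lemma ip_smult_right: "dim_vec v = dim_vec u \<Longrightarrow> ip u (c \<cdot>\<^sub>v v) = c * ip u v"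
  by (simp add: ip_def sum_distrib_left algebra_simps)

lemma ip_append:
  assumes "dim_vec u1 = dim_vec v1" "dim_vec u2 = dim_vec v2"
  shows "ip (u1 @\<^sub>v u2) (v1 @\<^sub>v v2) = ip u1 v1 + ip u2 v2"
proof -
  have ip: "ip a b = map_vec cnj a \<bullet> b" if "dim_vec a = dim_vec b" for a b
    using that by (simp add: ip_def scalar_prod_def atLeast0LessThan)
  have app: "map_vec cnj (u1 @\<^sub>v u2) = map_vec cnj u1 @\<^sub>v map_vec cnj u2" by (intro eq_vecI) auto
  have c: "map_vec cnj u1 \<in> carrier_vec (dim_vec v1)" "map_vec cnj u2 \<in> carrier_vec (dim_vec v2)"
    using assms by (auto intro!: carrier_vecI)
  show ?thesis
    using assms scalar_prod_append[OF c carrier_vec_dim_vec carrier_vec_dim_vec] by (simp add: ip app)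
qed

lemma ip_self: "ip v v = of_real ((vnorm v)\<^sup>2)"
proof -
  have "ip v v = (\<Sum>i<dim_vec v. of_real ((cmod (v $ i))\<^sup>2))"
    unfolding ip_def by (intro sum.cong refl) (simp only: complex_norm_square mult.commute)
  also have "\<dots> = of_real ((vnorm v)\<^sup>2)"
    unfolding vnorm_def by (simp add: sum_nonneg)
  finally show ?thesis .
qed

lemma vnorm_nonneg [simp]: "0 \<le> vnorm v"
  by (simp add: vnorm_def sum_nonneg)

lemma vnorm_eq_0_iff: "vnorm v = 0 \<longleftrightarrow> v = 0\<^sub>v (dim_vec v)"
  by (auto simp: vnorm_def sum_nonneg_eq_0_iff vec_eq_iff)

lemma ip_self_eq_0_iff: "ip v v = 0 \<longleftrightarrow> v = 0\<^sub>v (dim_vec v)"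
  unfolding ip_self using vnorm_eq_0_iff[of v] by simp

lemma vnorm_smult: "vnorm (z \<cdot>\<^sub>v v) = cmod z * vnorm v"
  by (simp add: vnorm_def norm_mult power_mult_distrib sum_distrib_left[symmetric] real_sqrt_mult)

lemma vnorm_append: "(vnorm (u @\<^sub>v v))\<^sup>2 = (vnorm u)\<^sup>2 + (vnorm v)\<^sup>2"
proof -
  let ?f = "\<lambda>i. (cmod ((u @\<^sub>v v) $ i))\<^sup>2"
  have "sum ?f {..<dim_vec u + dim_vec v}
    = sum ?f {..<dim_vec u} + sum ?f {dim_vec u..<dim_vec v + dim_vec u}"
    by (subst sum.union_disjoint[symmetric]) (auto intro!: sum.cong)
  also have "sum ?f {dim_vec u..<dim_vec v + dim_vec u} = (\<Sum>i<dim_vec v. ?f (i + dim_vec u))"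
    by (subst sum.shift_bounds_nat_ivl[of _ 0, simplified]) (simp add: atLeast0LessThan)
  finally show ?thesis
    by (simp add: vnorm_def sum_nonneg)
qed

lemma cmod_index_le_vnorm:
  assumes "i < dim_vec v"
  shows "cmod (v $ i) \<le> vnorm v"
proof -
  have "(cmod (v $ i))\<^sup>2 \<le> (\<Sum>j<dim_vec v. (cmod (v $ j))\<^sup>2)"
    using assms by (intro member_le_sum) auto
  then show ?thesis unfolding vnorm_def by (rule real_le_rsqrt)
qed

lemma vnorm_zero [simp]: "vnorm (0\<^sub>v n) = 0"
  by (simp add: vnorm_def)

lemma vnorm_unit_vec: "i < n \<Longrightarrow> vnorm (unit_vec n i) = 1"
proof -
  assume i: "i < n"
  have "(\<Sum>j<n. (cmod (unit_vec n i $ j))\<^sup>2) = (\<Sum>j<n. if j = i then 1 else 0)"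
    by (rule sum.cong) (use i in auto)
  then show ?thesis using i by (simp add: vnorm_def)
qed

lemma mat_eq_zero_of_mult_vec:
  fixes X :: "complex mat"
  assumes "X \<in> carrier_mat a b" "\<And>v. v \<in> carrier_vec b \<Longrightarrow> X *\<^sub>v v = 0\<^sub>v a"
  shows "X = 0\<^sub>m a b"
proof (rule eq_matI)
  fix i j assume ij: "i < dim_row (0\<^sub>m a b)" "j < dim_col (0\<^sub>m a b)"
  then have "(X *\<^sub>v unit_vec b j) $ i = 0" using assms(2)[of "unit_vec b j"] by simp
  then show "X $$ (i,j) = 0\<^sub>m a b $$ (i,j)" using ij assms(1) by simp
qed (use assms in auto)

text \<open>The quadratic form of \<open>hadj X * X\<close> at v is the squared norm of X v.\<close>

lemma hadj_mult_self_eq_zero: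
  assumes "X \<in> carrier_mat a b" "hadj X * X = 0\<^sub>m b b"
  shows "X = 0\<^sub>m a b"
proof (rule mat_eq_zero_of_mult_vec[OF assms(1)])
  fix v :: "complex vec" assume v: "v \<in> carrier_vec b"
  have "ip (X *\<^sub>v v) (X *\<^sub>v v) = ip (hadj (hadj X * X) *\<^sub>v v) v"
    using assms(1) v by (simp add: hadj_mult mult_mat_vec_assoc_dims ip_hadj[of _ "hadj X", simplified] ip_hadj)
  also have "\<dots> = 0" using v unfolding assms(2) by (simp add: ip_def)
  finally show "X *\<^sub>v v = 0\<^sub>v a" using assms(1) by (simp add: ip_self_eq_0_iff)
qed

subsection \<open>Unitary diagonalization, square roots and Moore--Penrose inverses\<close>

text \<open>An orthogonal basis starting with v is normalised vector by vector. Gram-Schmidt keeps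
  its first vector, so the first column remains a multiple of v.\<close>

lemma unitary_with_first_column:
  fixes v :: "complex vec"
  assumes v: "v \<in> carrier_vec n" "v \<noteq> 0\<^sub>v n" and n: "n \<noteq> 0"
  obtains W c where "W \<in> carrier_mat n n" "hadj W * W = 1\<^sub>m n" "W * hadj W = 1\<^sub>m n"
    "c \<noteq> 0" "col W 0 = c \<cdot>\<^sub>v v"
proof -
  interpret cof_vec_space n "TYPE(complex)" .
  define b where "b = basis_completion v"
  from basis_completion[OF v(1,2), folded b_def]
  have dist_b: "distinct b" and indep: "\<not> lin_dep (set b)" and b: "set b \<subseteq> carrier_vec n"
    and hdb: "hd b = v" and len_b: "length b = n" by auto
  define ws where "ws = gram_schmidt n b"
  from hdb len_b n obtain vs where bv: "b = v # vs" by (cases b) auto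
  from gram_schmidt_result[OF b dist_b indep refl, folded ws_def]
  have ws: "set ws \<subseteq> carrier_vec n" "corthogonal ws" "length ws = n" by (auto simp: len_b)
  from gram_schmidt_hd[OF v(1), of vs, folded bv] have "hd ws = v" unfolding ws_def .
  then have ws0: "ws ! 0 = v" using ws n by (cases ws) auto
  have dim: "dim_vec (ws ! j) = n" if "j < n" for j using ws that by (metis carrier_vecD nth_mem subsetD)
  have ipws: "ip (ws ! i) (ws ! j) = 0 \<longleftrightarrow> i \<noteq> j" if "i < n" "j < n" for i j
  proof -
    have "(ws ! j) \<bullet>c (ws ! i) = ip (ws ! i) (ws ! j)"
      using that dim by (auto simp: ip_def scalar_prod_def atLeast0LessThan intro!: sum.cong)
    then show ?thesis using corthogonalD[OF ws(2), of j i] that ws(3) by auto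
  qed
  \<comment> \<open>\<open>corthogonal\<close> includes that no vector is orthogonal to itself, so
    all norms are nonzero and may be divided by.\<close>
  have pos: "vnorm (ws ! j) \<noteq> 0" if "j < n" for j
    using ipws[of j j] that by (simp add: ip_self)
  define W where "W = mat n n (\<lambda>(i,j). (ws ! j) $ i / of_real (vnorm (ws ! j)))"
  have W: "W \<in> carrier_mat n n" by (simp add: W_def)
  have unit: "hadj W * W = 1\<^sub>m n"
  proof (rule eq_matI)
    fix i j assume "i < dim_row (1\<^sub>m n)" "j < dim_col (1\<^sub>m n)"
    then have ij: "i < n" "j < n" by auto
    have "(hadj W * W) $$ (i,j) = (\<Sum>k<n. cnj (W $$ (k,i)) * W $$ (k,j))"
      using ij W by (auto simp: scalar_prod_def atLeast0LessThan)
    also have "\<dots> = (\<Sum>k<n. cnj (ws ! i $ k) * (ws ! j) $ k) / (of_real (vnorm (ws ! i)) * of_real (vnorm (ws ! j)))"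
      using ij by (auto simp: W_def sum_divide_distrib intro!: sum.cong)
    also have "\<dots> = ip (ws ! i) (ws ! j) / (of_real (vnorm (ws ! i)) * of_real (vnorm (ws ! j)))"
      using ij dim by (simp add: ip_def)
    also have "\<dots> = 1\<^sub>m n $$ (i,j)"
      using ipws[OF ij] ij pos by (cases "i = j") (auto simp: ip_self power2_eq_square)
    finally show "(hadj W * W) $$ (i,j) = 1\<^sub>m n $$ (i,j)" .
  qed (use W in auto)
  show ?thesis
  proof (rule that[OF W unit])
    show "W * hadj W = 1\<^sub>m n"
      by (rule mat_mult_left_right_inverse[OF _ W unit]) (use W in auto)
    show "1 / of_real (vnorm v) \<noteq> (0::complex)" using pos[of 0] n ws0 by simp
    show "col W 0 = (1 / of_real (vnorm v)) \<cdot>\<^sub>v v"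
      using n ws0 v(1) by (intro eq_vecI) (auto simp: W_def)
  qed
qed

lemma eigenvalue_exists:
  assumes "(A :: complex mat) \<in> carrier_mat n n" "n \<noteq> 0"
  obtains v e where "v \<in> carrier_vec n" "v \<noteq> 0\<^sub>v n" "A *\<^sub>v v = e \<cdot>\<^sub>v v"
  using spectrum_non_empty[OF assms(1)] assms
  unfolding spectrum_def eigenvalue_def eigenvector_def by auto

text \<open>Deflation: in a unitary basis starting with an eigenvector the first column of the
  matrix is a multiple of the first unit vector, and self-adjointness clears the first row as well.
  The diagonal is complex at this stage; its reality is extracted afterwards.\<close>

lemma hermitian_diagonalization_complex:
  assumes "A \<in> carrier_mat n n" "hadj A = A"
  shows "\<exists>V d. V \<in> carrier_mat n n \<and> hadj V * V = 1\<^sub>m n \<and> A = V * mat_diag n d * hadj V"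
  using assms
proof (induction n arbitrary: A)
  case 0
  then show ?case by (intro exI[of _ "1\<^sub>m 0"] exI[of _ "\<lambda>_. 0"]) (auto intro!: eq_matI)
next
  case (Suc k)
  let ?n = "Suc k"
  from eigenvalue_exists[OF Suc.prems(1)] obtain v e
    where v: "v \<in> carrier_vec ?n" "v \<noteq> 0\<^sub>v ?n" "A *\<^sub>v v = e \<cdot>\<^sub>v v" by auto
  from unitary_with_first_column[OF v(1,2)] obtain W c
    where W: "W \<in> carrier_mat ?n ?n" "hadj W * W = 1\<^sub>m ?n" "W * hadj W = 1\<^sub>m ?n"
      and c: "c \<noteq> 0" "col W 0 = c \<cdot>\<^sub>v v" by auto
  define A' where "A' = hadj W * A * W"
  have dims: "dim_row W = ?n" "dim_col W = ?n" "dim_row A = ?n" "dim_col A = ?n"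
    using W Suc.prems by auto
  have A': "A' \<in> carrier_mat ?n ?n" "hadj A' = A'"
    using W Suc.prems by (auto simp: A'_def hadj_mult mult_assoc_dims)
  have AW: "A * W = W * A'"
    unfolding A'_def using W(3) dims by (simp add: mult_assoc_dims[symmetric])
  have A'A: "A = W * A' * hadj W"
    unfolding AW[symmetric] using W(3) dims by (simp add: mult_assoc_dims)
  have col0: "A' $$ (i,0) = (if i = 0 then e else 0)" if "i < ?n" for i
  proof -
    have "A *\<^sub>v col W 0 = e \<cdot>\<^sub>v col W 0"
      using v Suc.prems c by (simp add: mult_mat_smult_vec_dims smult_smult_assoc mult.commute)
    then have "hadj W *\<^sub>v (A *\<^sub>v col W 0) = hadj W *\<^sub>v (e \<cdot>\<^sub>v col W 0)" by simp
    also have "\<dots> = e \<cdot>\<^sub>v (hadj W *\<^sub>v col W 0)"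
      using W by (simp add: mult_mat_smult_vec_dims)
    also have "hadj W *\<^sub>v col W 0 = col (hadj W * W) 0" using dims by (intro eq_vecI) auto
    also have "col (hadj W * W) 0 = unit_vec ?n 0" using W by simp
    also have "hadj W *\<^sub>v (A *\<^sub>v col W 0) = col A' 0"
      unfolding A'_def using dims by (intro eq_vecI) (auto simp: mult_mat_vec_assoc_dims[symmetric])
    finally have "col A' 0 $ i = (e \<cdot>\<^sub>v unit_vec ?n 0) $ i" by simp
    then show ?thesis using that A' by simp
  qed
  have row0: "A' $$ (0,j) = 0" if "j < ?n" "j \<noteq> 0" for j
    using col0[OF that(1)] that A' index_hadj[of 0 A' j] by simp
  define A3 where "A3 = mat k k (\<lambda>(i,j). A' $$ (Suc i, Suc j))"
  have A3: "A3 \<in> carrier_mat k k" by (simp add: A3_def)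
  have "hadj A3 = A3"
  proof (rule eq_matI)
    fix i j assume "i < dim_row A3" "j < dim_col A3"
    then show "hadj A3 $$ (i,j) = A3 $$ (i,j)"
      using A' index_hadj[of "Suc i" A' "Suc j"] by (simp add: A3_def)
  qed (use A3 in auto)
  from Suc.IH[OF A3 this] obtain P d where P: "P \<in> carrier_mat k k" "hadj P * P = 1\<^sub>m k"
    and A3P: "A3 = P * mat_diag k d * hadj P" by blast
  let ?d = "\<lambda>i. case i of 0 \<Rightarrow> e | Suc j \<Rightarrow> d j"
  have A'blk: "A' = four_block_mat (e \<cdot>\<^sub>m 1\<^sub>m 1) (0\<^sub>m 1 k) (0\<^sub>m k 1) A3"
    using A' col0 row0 by (intro eq_matI) (auto simp: A3_def)
  define P' where "P' = four_block_mat (1\<^sub>m 1) (0\<^sub>m 1 k) (0\<^sub>m k 1) P"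
  have diag: "mat_diag ?n ?d = four_block_mat (e \<cdot>\<^sub>m 1\<^sub>m 1) (0\<^sub>m 1 k) (0\<^sub>m k 1) (mat_diag k d)"
    by (intro eq_matI) (auto simp: mat_diag_def split: nat.splits)
  have P': "P' \<in> carrier_mat ?n ?n" using P by (auto simp: P'_def)
  have hP': "hadj P' = four_block_mat (1\<^sub>m 1) (0\<^sub>m 1 k) (0\<^sub>m k 1) (hadj P)"
    unfolding P'_def using P by (subst hadj_four_block_mat) auto
  have unitP': "hadj P' * P' = 1\<^sub>m ?n"
    unfolding hP' unfolding P'_def using P four_block_one_mat[of 1 k]
    by (subst mult_four_block_mat[of _ 1 1 _ k _ k _ _ 1 _ k]) auto
  have blk: "four_block_mat X1 (0\<^sub>m 1 k) (0\<^sub>m k 1) Y1 * four_block_mat X2 (0\<^sub>m 1 k) (0\<^sub>m k 1) Y2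
      = four_block_mat (X1 * X2) (0\<^sub>m 1 k) (0\<^sub>m k 1) (Y1 * Y2)"
    if "X1 \<in> carrier_mat 1 1" "X2 \<in> carrier_mat 1 1" "Y1 \<in> carrier_mat k k" "Y2 \<in> carrier_mat k k"
    for X1 X2 Y1 Y2 :: "complex mat"
    using that by (subst mult_four_block_mat[of _ 1 1 _ k _ k _ _ 1 _ k]) auto
  have eq: "A' = P' * mat_diag ?n ?d * hadj P'"
    unfolding hP' diag A'blk A3P unfolding P'_def using P by (simp add: blk[simplified])
  have dP: "dim_row P' = ?n" "dim_col P' = ?n" using P' by auto
  have dd: "dim_row (mat_diag ?n ?d) = ?n" "dim_col (mat_diag ?n ?d) = ?n" by (auto simp: mat_diag_def)
  show ?case
  proof (intro exI conjI)
    show "W * P' \<in> carrier_mat ?n ?n" using W P' by auto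
    have "hadj (W * P') * (W * P') = hadj P' * ((hadj W * W) * P')"
      using dims dP by (simp add: hadj_mult mult_assoc_dims)
    also have "\<dots> = 1\<^sub>m ?n" using W unitP' dP by simp
    finally show "hadj (W * P') * (W * P') = 1\<^sub>m ?n" .
    show "A = W * P' * mat_diag ?n ?d * hadj (W * P')"
      unfolding A'A eq using dims dP dd by (simp add: hadj_mult mult_assoc_dims)
  qed
qed

text \<open>The diagonal matrix equals \<open>hadj V * A * V\<close>, so it is self-adjoint and its
  entries are real.\<close>

lemma hermitian_diagonalization:
  assumes A: "A \<in> carrier_mat n n" "hadj A = A"
  obtains V d where "V \<in> carrier_mat n n" "hadj V * V = 1\<^sub>m n" "V * hadj V = 1\<^sub>m n"
    "A = V * mat_diag n (\<lambda>i. of_real (d i)) * hadj V"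
proof -
  from hermitian_diagonalization_complex[OF A] obtain V d
    where V: "V \<in> carrier_mat n n" "hadj V * V = 1\<^sub>m n" and AV: "A = V * mat_diag n d * hadj V" by blast
  let ?D = "mat_diag n d"
  have dims: "dim_row V = n" "dim_col V = n" "dim_row ?D = n" "dim_col ?D = n"
    using V by (auto simp: mat_diag_def)
  have "hadj V * A * V = (hadj V * V) * (?D * (hadj V * V))"
    unfolding AV using dims by (simp add: mult_assoc_dims)
  also have "\<dots> = ?D" using V dims by simp
  finally have D: "hadj V * A * V = ?D" .
  have "hadj ?D = ?D"
    unfolding D[symmetric] using dims A by (simp add: hadj_mult mult_assoc_dims)
  then have "cnj (d i) = d i" if "i < n" for i
    using index_hadj[of i ?D i] that by (simp add: mat_diag_def)
  then have "complex_of_real (Re (d i)) = d i" if "i < n" for i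
    using that by (metis Reals_cnj_iff of_real_Re)
  then have "?D = mat_diag n (\<lambda>i. of_real (Re (d i)))"
    by (intro eq_matI) (auto simp: mat_diag_def)
  moreover have "V * hadj V = 1\<^sub>m n"
    by (rule mat_mult_left_right_inverse[OF _ V(1) V(2)]) (use V in auto)
  ultimately show ?thesis using that[OF V] AV by metis
qed

section \<open>Positive semidefinite matrices and their square roots\<close>

lemma psd_iff:
  "psd M \<longleftrightarrow> M \<in> carrier_mat (dim_row M) (dim_row M) \<and> hadj M = M \<and>
     (\<forall>v \<in> carrier_vec (dim_row M). 0 \<le> Re (ip v (M *\<^sub>v v)))"
  by (simp add: psd_def ip_def)

lemma psd_congruence:
  assumes "psd M" "M \<in> carrier_mat n n" "X \<in> carrier_mat n k"
  shows "psd (hadj X * M * X)"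
  unfolding psd_iff
proof (intro conjI ballI)
  fix v :: "complex vec" assume "v \<in> carrier_vec (dim_row (hadj X * M * X))"
  then have v: "dim_vec v = k" using assms by simp
  have "ip v (hadj X * M * X *\<^sub>v v) = ip (X *\<^sub>v v) (M *\<^sub>v (X *\<^sub>v v))"
    using assms v ip_hadj[of v "hadj X"] by (simp add: mult_mat_vec_assoc_dims)
  moreover have "X *\<^sub>v v \<in> carrier_vec n" using assms by (auto intro!: carrier_vecI)
  ultimately show "0 \<le> Re (ip v (hadj X * M * X *\<^sub>v v))"
    using assms by (auto simp: psd_iff)
qed (use assms in \<open>auto simp: psd_iff hadj_mult mult_assoc_dims intro!: carrier_matI\<close>)

lemma hadj_mat_diag [simp]: "hadj (mat_diag n d) = mat_diag n (\<lambda>i. cnj (d i))"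
  by (rule eq_matI) (auto simp: mat_diag_def)

lemma dim_mat_diag [simp]: "dim_row (mat_diag n d) = n" "dim_col (mat_diag n d) = n"
  by (auto simp: mat_diag_def)

lemma ip_mat_diag:
  assumes "v \<in> carrier_vec n"
  shows "ip v (mat_diag n d *\<^sub>v v) = (\<Sum>i<n. d i * of_real ((cmod (v $ i))\<^sup>2))"
proof -
  have "(mat_diag n d *\<^sub>v v) $ i = d i * v $ i" if "i < n" for i
  proof -
    have "(mat_diag n d *\<^sub>v v) $ i = (\<Sum>j<n. (if i = j then d j else 0) * v $ j)"
      using that assms by (auto simp: mat_diag_def scalar_prod_def atLeast0LessThan)
    also have "\<dots> = (\<Sum>j<n. if j = i then d i * v $ i else 0)" by (rule sum.cong) auto
    finally show ?thesis using that by simp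
  qed
  then show ?thesis
    using assms unfolding ip_def
    by (intro sum.cong) (auto simp: complex_norm_square simp del: of_real_power)
qed

lemma psd_mat_diag:
  assumes "\<And>i. i < n \<Longrightarrow> 0 \<le> d i"
  shows "psd (mat_diag n (\<lambda>i. of_real (d i)))"
  unfolding psd_iff using assms by (auto simp: ip_mat_diag intro!: sum_nonneg)

lemma psd_sqrt_exists:
  assumes "psd M" "M \<in> carrier_mat n n"
  obtains S where "psd S" "S \<in> carrier_mat n n" "S * S = M"
proof -
  from assms have "hadj M = M" by (simp add: psd_iff)
  from hermitian_diagonalization[OF assms(2) this] obtain V d
    where V: "V \<in> carrier_mat n n" "hadj V * V = 1\<^sub>m n" "V * hadj V = 1\<^sub>m n"
      and M: "M = V * mat_diag n (\<lambda>i. of_real (d i)) * hadj V" by blast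
  let ?D = "mat_diag n (\<lambda>i. complex_of_real (d i))"
  let ?E = "mat_diag n (\<lambda>i. complex_of_real (sqrt (d i)))"
  have dims: "dim_row V = n" "dim_col V = n" using V by auto
  have "hadj V * M * V = (hadj V * V) * (?D * (hadj V * V))"
    unfolding M using dims by (simp add: mult_assoc_dims)
  also have "\<dots> = ?D" using V dims by simp
  finally have D: "psd ?D" using psd_congruence[OF assms V(1)] by simp
  have "0 \<le> d i" if "i < n" for i
  proof -
    have "ip (unit_vec n i) (?D *\<^sub>v unit_vec n i) = (\<Sum>j<n. if j = i then of_real (d i) else 0)"
      by (subst ip_mat_diag, simp, rule sum.cong) (use that in auto)
    moreover have "0 \<le> Re (ip (unit_vec n i) (?D *\<^sub>v unit_vec n i))"
      using D by (auto simp: psd_iff)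
    ultimately show ?thesis using that by simp
  qed note d = this
  show ?thesis
  proof
    show "psd (V * ?E * hadj V)"
      using psd_congruence[OF psd_mat_diag, of n "\<lambda>i. sqrt (d i)" n "hadj V" n] d V by simp
    show "V * ?E * hadj V \<in> carrier_mat n n" using V by auto
    have "V * ?E * hadj V * (V * ?E * hadj V) = V * ?E * (hadj V * V) * ?E * hadj V"
      using dims by (simp add: mult_assoc_dims)
    also have "\<dots> = V * (?E * ?E) * hadj V" using V dims by (simp add: mult_assoc_dims)
    also have "?E * ?E = mat_diag n (\<lambda>i. of_real (sqrt (d i) * sqrt (d i)))"
      by (simp only: mat_diag_diag of_real_mult)
    also have "\<dots> = ?D"
      using d by (intro eq_matI) (auto simp: mat_diag_def simp del: of_real_mult)
    finally show "V * ?E * hadj V * (V * ?E * hadj V) = M" using M by simp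
  qed
qed

text \<open>With a self-adjoint root S of M, the form at v is the squared norm of S v; if it
  vanishes, so does S v, and with it M v.\<close>

lemma psd_kernel:
  assumes "psd M" "M \<in> carrier_mat n n" "v \<in> carrier_vec n" "Re (ip v (M *\<^sub>v v)) = 0"
  shows "M *\<^sub>v v = 0\<^sub>v n"
proof -
  obtain S where S: "psd S" "S \<in> carrier_mat n n" "S * S = M" using psd_sqrt_exists[OF assms(1,2)] .
  have "ip v (M *\<^sub>v v) = ip (S *\<^sub>v v) (S *\<^sub>v v)"
    using S assms(3) ip_hadj[of v S "S *\<^sub>v v"]
    by (simp add: mult_mat_vec_assoc_dims psd_iff flip: S(3))
  then have "S *\<^sub>v v = 0\<^sub>v n" using assms(4) S by (simp add: ip_self vnorm_eq_0_iff)
  then have "S *\<^sub>v (S *\<^sub>v v) = 0\<^sub>v n" using S by (auto intro!: eq_vecI)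
  then show ?thesis using S assms(3) by (simp add: mult_mat_vec_assoc_dims flip: S(3))
qed

lemma psd_sqrt_unique:
  assumes S: "psd S" "S \<in> carrier_mat n n" and T: "psd T" "T \<in> carrier_mat n n"
    and eq: "S * S = T * T"
  shows "S = T"
proof -
  define X where "X = S - T"
  have hST: "hadj S = S" "hadj T = T" using S T by (auto simp: psd_iff)
  have dims: "dim_row S = n" "dim_col S = n" "dim_row T = n" "dim_col T = n" using S T by auto
  have X: "X \<in> carrier_mat n n" "hadj X = X"
    using S T hST by (auto simp: X_def hadj_minus)
  \<comment> \<open>\<open>S X + X T = S\<^sup>2 - T\<^sup>2 = 0\<close>, so an eigenvector of \<open>X\<close> with nonzero eigenvalue lies in both kernels.\<close>
  have zero: "S * X + X * T = 0\<^sub>m n n"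
  proof -
    have "S * X + X * T = (S * S - S * T) + (S * T - T * T)"
      using dims by (simp add: X_def mult_minus_distrib_dims minus_mult_distrib_dims)
    also have "\<dots> = 0\<^sub>m n n" unfolding eq using dims by (intro eq_matI) auto
    finally show ?thesis .
  qed
  from hermitian_diagonalization[OF X] obtain V d
    where V: "V \<in> carrier_mat n n" "hadj V * V = 1\<^sub>m n" "V * hadj V = 1\<^sub>m n"
      and XV: "X = V * mat_diag n (\<lambda>i. of_real (d i)) * hadj V" by blast
  have dV: "dim_row V = n" "dim_col V = n" using V by auto
  have "d i = 0" if i: "i < n" for i
  proof (rule ccontr)
    assume di: "d i \<noteq> 0"
    define v where "v = V *\<^sub>v unit_vec n i"
    have v: "v \<in> carrier_vec n" "dim_vec v = n" using V by (auto simp: v_def)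
    have Vv: "hadj V *\<^sub>v v = unit_vec n i"
      using V dV by (simp add: v_def flip: mult_mat_vec_assoc_dims)
    have diag: "mat_diag n (\<lambda>i. of_real (d i)) *\<^sub>v unit_vec n i = complex_of_real (d i) \<cdot>\<^sub>v unit_vec n i"
      using i by (intro eq_vecI) (auto simp: mat_diag_def)
    have Xv: "X *\<^sub>v v = complex_of_real (d i) \<cdot>\<^sub>v v"
      unfolding XV using dV v Vv V(1)
      by (simp add: mult_mat_vec_assoc_dims diag mult_mat_smult_vec_dims) (simp add: v_def)
    have "0 = ip v ((S * X + X * T) *\<^sub>v v)" unfolding zero using v by (simp add: ip_def)
    also have "\<dots> = ip v (S *\<^sub>v (X *\<^sub>v v)) + ip v (X *\<^sub>v (T *\<^sub>v v))"
      using dims X v by (simp add: add_mult_mat_vec_dims mult_mat_vec_assoc_dims)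
        (simp add: ip_def sum.distrib algebra_simps)
    also have "ip v (X *\<^sub>v (T *\<^sub>v v)) = ip (X *\<^sub>v v) (T *\<^sub>v v)"
      using ip_hadj[of v X "T *\<^sub>v v"] X dims v by simp
    \<comment> \<open>The eigenvalue is real, so it leaves the conjugated argument unchanged and
      both summands carry the same factor.\<close>
    also have "\<dots> = of_real (d i) * ip v (T *\<^sub>v v)"
      unfolding Xv using v by (simp add: ip_def sum_distrib_left algebra_simps)
    also have "ip v (S *\<^sub>v (X *\<^sub>v v)) = of_real (d i) * ip v (S *\<^sub>v v)"
      unfolding Xv using v S by (simp add: mult_mat_smult_vec_dims ip_smult_right)
    finally have "complex_of_real (d i) * (ip v (S *\<^sub>v v) + ip v (T *\<^sub>v v)) = 0"
      by (simp add: distrib_left)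
    then have "Re (ip v (S *\<^sub>v v) + ip v (T *\<^sub>v v)) = 0"
      using di by simp
    then have "Re (ip v (S *\<^sub>v v)) + Re (ip v (T *\<^sub>v v)) = 0" by simp
    moreover have "0 \<le> Re (ip v (S *\<^sub>v v))" "0 \<le> Re (ip v (T *\<^sub>v v))"
      using S T v by (auto simp: psd_iff)
    ultimately have "S *\<^sub>v v = 0\<^sub>v n" "T *\<^sub>v v = 0\<^sub>v n"
      using psd_kernel[OF S v(1)] psd_kernel[OF T v(1)] by auto
    then have "X *\<^sub>v v = 0\<^sub>v n" using dims v by (simp add: X_def minus_mult_mat_vec_dims)
    then have "v = 0\<^sub>v n" using Xv di v by (auto simp: vec_eq_iff)
    moreover have "hadj V *\<^sub>v 0\<^sub>v n = 0\<^sub>v n" using dV by (intro eq_vecI) (auto simp: scalar_prod_def)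
    ultimately have "unit_vec n i = (0\<^sub>v n :: complex vec)" using Vv by simp
    then show False using i by (metis index_unit_vec(1) index_zero_vec(1) zero_neq_one)
  qed
  then have "mat_diag n (\<lambda>i. complex_of_real (d i)) = 0\<^sub>m n n"
    by (intro eq_matI) (auto simp: mat_diag_def)
  then have "X = 0\<^sub>m n n" unfolding XV using dV by simp
  then have "S - T = 0\<^sub>m n n" unfolding X_def .
  then show ?thesis using S(2) T(2) by (rule eq_mat_of_minus_eq_zero)
qed

lemma psd_sqrt_properties:
  assumes "psd M" "M \<in> carrier_mat n n"
  shows "psd_sqrt M \<in> carrier_mat n n" "hadj (psd_sqrt M) = psd_sqrt M" "psd_sqrt M * psd_sqrt M = M"
proof -
  obtain S where S: "psd S" "S \<in> carrier_mat n n" "S * S = M" using psd_sqrt_exists[OF assms] .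
  have "psd_sqrt M = S"
    unfolding psd_sqrt_def
  proof (rule the_equality)
    fix T assume T: "psd T \<and> dim_row T = dim_row M \<and> T * T = M"
    then have "T \<in> carrier_mat n n" using assms by (auto simp: psd_iff)
    then show "T = S" using psd_sqrt_unique[of T n S] T S by auto
  qed (use S assms in auto)
  then show "psd_sqrt M \<in> carrier_mat n n" "hadj (psd_sqrt M) = psd_sqrt M" "psd_sqrt M * psd_sqrt M = M"
    using S by (auto simp: psd_iff)
qed

section \<open>Moore-Penrose inverses\<close>

definition is_mp_inv :: "complex mat \<Rightarrow> complex mat \<Rightarrow> bool" where
  "is_mp_inv T S \<longleftrightarrow> S \<in> carrier_mat (dim_col T) (dim_row T) \<and>
     T * S * T = T \<and> S * T * S = S \<and> hadj (T * S) = T * S \<and> hadj (S * T) = S * T"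

text \<open>\<open>T * S\<close> and \<open>T * S'\<close> are orthogonal projections with the same
  range, hence equal; likewise \<open>S * T\<close> and \<open>S' * T\<close>. Substituting both
  into \<open>S * T * S\<close> turns S into S'.\<close>

lemma is_mp_inv_unique:
  assumes "is_mp_inv T S" "is_mp_inv T S'"
  shows "S = S'"
proof -
  have dims: "dim_row S = dim_col T" "dim_col S = dim_row T" "dim_row S' = dim_col T" "dim_col S' = dim_row T"
    using assms by (auto simp: is_mp_inv_def)
  have a: "T * S * T = T" "S * T * S = S" "hadj (T * S) = T * S" "hadj (S * T) = S * T"
    and b: "T * S' * T = T" "S' * T * S' = S'" "hadj (T * S') = T * S'" "hadj (S' * T) = S' * T"
    using assms by (auto simp only: is_mp_inv_def)
  have "T * S = (T * S' * T) * S" by (simp only: b(1))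
  also have "\<dots> = (T * S') * (T * S)" using dims by (simp add: mult_assoc_dims)
  also have "\<dots> = hadj ((T * S) * (T * S'))"
    by (subst hadj_mult) (simp_all only: a b dims index_mult_mat)
  also have "(T * S) * (T * S') = (T * S * T) * S'" using dims by (simp add: mult_assoc_dims)
  finally have 1: "T * S = T * S'" by (simp only: a b)
  have "S * T = S * (T * S' * T)" by (simp only: b(1))
  also have "\<dots> = (S * T) * (S' * T)" using dims by (simp add: mult_assoc_dims)
  also have "\<dots> = hadj ((S' * T) * (S * T))"
    by (subst hadj_mult) (simp_all only: a b dims index_mult_mat)
  also have "(S' * T) * (S * T) = S' * (T * S * T)" using dims by (simp add: mult_assoc_dims)
  finally have 2: "S * T = S' * T" by (simp only: a b)
  have "S = S * T * S" by (simp only: a)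
  also have "\<dots> = S' * (T * S)" unfolding 2 using dims by (simp add: mult_assoc_dims)
  also have "\<dots> = S' * T * S'" unfolding 1 using dims by (simp add: mult_assoc_dims)
  finally show ?thesis by (simp only: b)
qed

text \<open>Functions of the eigenvalues multiply pointwise, so the Penrose equations become
  equations between real numbers.\<close>

lemma is_mp_inv_hermitian:
  assumes L: "L \<in> carrier_mat n n" "hadj L = L"
  shows "is_mp_inv L (mp_inv L)"
proof -
  from hermitian_diagonalization[OF L] obtain V d
    where V: "V \<in> carrier_mat n n" "hadj V * V = 1\<^sub>m n" "V * hadj V = 1\<^sub>m n"
      and LV: "L = V * mat_diag n (\<lambda>i. of_real (d i)) * hadj V" by blast
  have dV: "dim_row V = n" "dim_col V = n" using V by auto
  let ?F = "\<lambda>f. V * mat_diag n (\<lambda>i. complex_of_real (f i)) * hadj V"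
  have mult: "?F f * ?F g = ?F (\<lambda>i. f i * g i)" for f g
  proof -
    have "?F f * ?F g = V * mat_diag n (\<lambda>i. complex_of_real (f i)) * (hadj V * V) *
        mat_diag n (\<lambda>i. complex_of_real (g i)) * hadj V"
      using dV by (simp add: mult_assoc_dims)
    also have "\<dots> = V * (mat_diag n (\<lambda>i. complex_of_real (f i)) * mat_diag n (\<lambda>i. complex_of_real (g i))) * hadj V"
      using dV V by (simp add: mult_assoc_dims)
    finally show ?thesis by simp
  qed
  have herm: "hadj (?F f) = ?F f" for f
    using dV by (simp add: hadj_mult mult_assoc_dims)
  \<comment> \<open>The convention \<open>inverse 0 = 0\<close> makes both laws true at a zero
    eigenvalue, and so \<open>inverse\<close> on the eigenvalues is the pseudo-inverse.\<close>
  have e: "x * inverse x * x = x" "inverse x * x * inverse x = inverse x" for x :: real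
    by (cases "x = 0"; simp)+
  have "is_mp_inv L (?F (\<lambda>i. inverse (d i)))"
    unfolding is_mp_inv_def LV mult herm e using V by auto
  then have "\<exists>!S. is_mp_inv L S" using is_mp_inv_unique by blast
  moreover have "mp_inv L = (THE S. is_mp_inv L S)"
    by (simp add: mp_inv_def is_mp_inv_def)
  ultimately show ?thesis by (metis theI')
qed

subsection \<open>The partial isometry\<close>

lemma weighted_hadj_mult_eq_zero:
  assumes X: "X \<in> carrier_mat a b" and W: "W \<in> carrier_mat a a"
    and definite: "\<And>v. v \<in> carrier_vec a \<Longrightarrow> ip v (W *\<^sub>v v) = 0 \<Longrightarrow> v = 0\<^sub>v a"
    and zero: "hadj X * W * X = 0\<^sub>m b b"
  shows "X = 0\<^sub>m a b"
proof (rule mat_eq_zero_of_mult_vec[OF X])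
  fix v :: "complex vec" assume v: "v \<in> carrier_vec b"
  have "ip (X *\<^sub>v v) (W *\<^sub>v (X *\<^sub>v v)) = ip v (hadj X * W * X *\<^sub>v v)"
    using X W v ip_hadj[of v "hadj X" "W *\<^sub>v (X *\<^sub>v v)"] by (simp add: mult_mat_vec_assoc_dims)
  also have "\<dots> = 0" unfolding zero using v by (simp add: ip_def)
  finally show "X *\<^sub>v v = 0\<^sub>v a" using definite X v by simp
qed

text \<open>U solves the normal equations of the W-weighted least squares problem for
  \<open>M U = N\<close>. The residual vanishes because equal products \<open>N * hadj N\<close> and
  \<open>M * hadj M\<close> give N and M the same range. The same equality eliminates N from
  \<open>U * hadj U\<close>.\<close>

lemma weighted_least_squares_partial_isometry:
  assumes M: "M \<in> carrier_mat a b" and N: "N \<in> carrier_mat a c" and W: "W \<in> carrier_mat a a" "hadj W = W"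
    and definite: "\<And>v. v \<in> carrier_vec a \<Longrightarrow> ip v (W *\<^sub>v v) = 0 \<Longrightarrow> v = 0\<^sub>v a"
    and eq: "N * hadj N = M * hadj M"
  defines "U \<equiv> mp_inv (hadj M * W * M) * (hadj M * W * N)"
  shows "U \<in> carrier_mat b c" "M * U = N" "partial_isometry U"
proof -
  define L where "L = hadj M * W * M"
  define J where "J = mp_inv L"
  define R where "R = hadj M * W * N"
  have U: "U = J * R" by (simp add: U_def J_def L_def R_def)
  have L: "L \<in> carrier_mat b b" "hadj L = L"
    using M W by (auto simp: L_def hadj_mult mult_assoc_dims)
  have "is_mp_inv L J" unfolding J_def by (rule is_mp_inv_hermitian[OF L])
  then have J: "J \<in> carrier_mat b b" "L * J * L = L" "J * L * J = J"
    "hadj (L * J) = L * J" "hadj (J * L) = J * L"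
    using L by (auto simp: is_mp_inv_def)
  have dims: "dim_row M = a" "dim_col M = b" "dim_row N = a" "dim_col N = c" "dim_row W = a" "dim_col W = a"
    "dim_row L = b" "dim_col L = b" "dim_row J = b" "dim_col J = b" "dim_row R = b" "dim_col R = c"
    using M N W L J by (auto simp: R_def)
  show Uc: "U \<in> carrier_mat b c" using J dims by (auto simp: U intro!: carrier_matI)
  have dU: "dim_row U = b" "dim_col U = c" using Uc by auto
  \<comment> \<open>L and M have the same kernel since W is definite; this brings equations for L
    back to M.\<close>
  have annihilate: "M * Z = 0\<^sub>m a k" if "Z \<in> carrier_mat b k" "L * Z = 0\<^sub>m b k" for Z k
  proof (rule weighted_hadj_mult_eq_zero[OF _ W(1) definite])
    have "hadj (M * Z) * W * (M * Z) = hadj Z * (L * Z)"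
      using that(1) dims by (simp add: L_def hadj_mult mult_assoc_dims)
    then show "hadj (M * Z) * W * (M * Z) = 0\<^sub>m k k" unfolding that(2) using that(1) by simp
  qed (use that M in auto)
  \<comment> \<open>I - L J is the orthogonal projection onto the kernel of L, which M annihilates.
    Taking adjoints, L J fixes the range of \<open>hadj M\<close>, so the normal equations
    \<open>L * U = R\<close> hold although L may be singular.\<close>
  have MZ: "M * (1\<^sub>m b - L * J) = 0\<^sub>m a b"
  proof -
    define Z where "Z = 1\<^sub>m b - L * J"
    have Z: "Z \<in> carrier_mat b b" "hadj Z = Z" using J L by (auto simp: Z_def hadj_minus)
    have ZL: "Z * L = 0\<^sub>m b b"
      using J(2) dims by (simp add: Z_def minus_mult_distrib_dims)
    have "M * Z = 0\<^sub>m a b"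
    proof (rule weighted_hadj_mult_eq_zero[OF _ W(1) definite])
      have "hadj (M * Z) * W * (M * Z) = (Z * L) * Z"
        using Z dims by (simp add: L_def hadj_mult mult_assoc_dims)
      then show "hadj (M * Z) * W * (M * Z) = 0\<^sub>m b b" unfolding ZL using Z by simp
    qed (use Z M in auto)
    then show ?thesis by (simp add: Z_def)
  qed
  have "L * J * hadj M = hadj M"
  proof -
    have "M = M * (L * J)"
      by (rule eq_mat_of_minus_eq_zero[of _ _ a b]) (use MZ dims in \<open>auto simp: mult_minus_distrib_dims\<close>)
    then have "hadj (M * (L * J)) = hadj M" by simp
    then show ?thesis using J(4) dims by (simp add: hadj_mult[of M "L * J"])
  qed
  then have LU: "L * U = R" unfolding U R_def using dims by (simp flip: mult_assoc_dims)
  define H where "H = M * hadj M"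
  have H: "H \<in> carrier_mat a a" "hadj H = H" using M by (auto simp: H_def hadj_mult)
  define K where "K = mp_inv H"
  have "is_mp_inv H K" unfolding K_def by (rule is_mp_inv_hermitian[OF H])
  then have K: "K \<in> carrier_mat a a" "H * K * H = H" "hadj (H * K) = H * K"
    using H by (auto simp: is_mp_inv_def)
  have dH: "dim_row H = a" "dim_col H = a" "dim_row K = a" "dim_col K = a" using H K by auto
  \<comment> \<open>The orthogonal projection onto the complement of the range of H. Since H is also
    \<open>N * hadj N\<close>, this projection kills N.\<close>
  define Z where "Z = 1\<^sub>m a - H * K"
  have Z: "Z \<in> carrier_mat a a" "hadj Z = Z" using K H by (auto simp: Z_def hadj_minus)
  have ZH: "Z * H = 0\<^sub>m a a" using K(2) dH by (simp add: Z_def minus_mult_distrib_dims)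
  have "hadj N * Z = 0\<^sub>m c a"
  proof (rule hadj_mult_self_eq_zero)
    have "hadj (hadj N * Z) * (hadj N * Z) = Z * (N * hadj N) * Z"
      using Z dims by (simp add: hadj_mult mult_assoc_dims)
    also have "\<dots> = 0\<^sub>m a a" unfolding eq H_def[symmetric] ZH using Z by simp
    finally show "hadj (hadj N * Z) * (hadj N * Z) = 0\<^sub>m a a" .
  qed (use Z N in auto)
  then have "hadj (hadj N * Z) = 0\<^sub>m a c" by simp
  then have ZN: "Z * N = 0\<^sub>m a c" using Z dims by (simp add: hadj_mult)
  have HKN: "N = H * K * N"
    by (rule eq_mat_of_minus_eq_zero[of _ _ a c])
      (use ZN dims dH in \<open>auto simp: Z_def minus_mult_distrib_dims\<close>)
  \<comment> \<open>An explicit solution of \<open>M U = N\<close>. It satisfies the normal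
    equations as well, so it differs from U by a matrix that L, and therefore M,
    annihilates.\<close>
  define U0 where "U0 = hadj M * (K * N)"
  have dU0: "dim_row U0 = b" "dim_col U0 = c" using dims by (auto simp: U0_def)
  have "M * U0 = H * K * N"
    using dims dH by (simp add: U0_def H_def mult_assoc_dims)
  then have MU0: "M * U0 = N" using HKN by metis
  have "L * U0 = R"
    using MU0 dims dU0 by (simp add: L_def R_def mult_assoc_dims)
  then have "L * (U - U0) = 0\<^sub>m b c"
    using LU dims dU dU0 by (simp add: mult_minus_distrib_dims)
  then have ME: "M * (U - U0) = 0\<^sub>m a c" 
    by (rule annihilate[rotated]) (use dU dU0 in \<open>auto intro!: carrier_matI\<close>)
  have "M * U = M * U0"
    by (rule eq_mat_of_minus_eq_zero[of _ _ a c])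
      (use ME dims dU dU0 in \<open>auto simp: mult_minus_distrib_dims\<close>)
  then show "M * U = N" by (simp only: MU0)
  \<comment> \<open>F maps M to the projection \<open>J * L\<close> and N to U; hence
    \<open>U * hadj U\<close> can be computed with \<open>M * hadj M\<close> in the middle, which
    gives that projection.\<close>
  define F where "F = J * hadj M * W"
  define Pi where "Pi = J * L"
  have dF: "dim_row F = b" "dim_col F = a" "dim_row Pi = b" "dim_col Pi = b" using dims by (auto simp: F_def Pi_def)
  have FM: "F * M = Pi" and FN: "F * N = U"
    using dims by (auto simp: F_def Pi_def L_def U R_def mult_assoc_dims)
  have Pi: "hadj Pi = Pi" "Pi * Pi = Pi"
    using J dims by (auto simp: Pi_def) (simp flip: mult_assoc_dims)
  have "U * hadj U = F * (N * hadj N) * hadj F"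
    using dims dF by (simp add: FN[symmetric] hadj_mult mult_assoc_dims)
  also have "\<dots> = (F * M) * hadj (F * M)"
    unfolding eq using dims dF by (simp add: hadj_mult mult_assoc_dims)
  finally have UU: "U * hadj U = Pi" by (simp add: FM Pi)
  have PiU: "Pi * U = U" using J(3) dims by (simp add: Pi_def U flip: mult_assoc_dims)
  have "hadj U * U * (hadj U * U) = hadj U * ((U * hadj U) * U)"
    using dU by (simp add: mult_assoc_dims)
  then show "partial_isometry U"
    unfolding partial_isometry_def UU PiU .
qed

text \<open>I - \<open>hadj U * U\<close> is an orthogonal projection F, and the squared norms of v
  and U v differ by the squared norm of F v.\<close>

lemma partial_isometry_contraction:
  assumes "partial_isometry U" "v \<in> carrier_vec (dim_col U)"
  shows "vnorm (U *\<^sub>v v) \<le> vnorm v"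
proof -
  let ?n = "dim_col U"
  define E where "E = hadj U * U"
  have E: "E * E = E" "hadj E = E" "dim_row E = ?n" "dim_col E = ?n"
    using assms(1) by (auto simp: E_def partial_isometry_def hadj_mult)
  define F where "F = 1\<^sub>m ?n - E"
  have F: "hadj F = F" "dim_row F = ?n" "dim_col F = ?n"
    using E by (auto simp: F_def hadj_minus)
  have FF: "F * F = F"
    using E by (auto simp: F_def mult_minus_distrib_dims minus_mult_distrib_dims intro!: eq_matI)
  have v: "dim_vec v = ?n" using assms(2) by simp
  have "of_real ((vnorm (F *\<^sub>v v))\<^sup>2) = ip v (F *\<^sub>v (F *\<^sub>v v))"
    using ip_hadj[of v F "F *\<^sub>v v"] F v by (simp add: ip_self)
  also have "\<dots> = ip v (F *\<^sub>v v)" using F v by (simp add: FF flip: mult_mat_vec_assoc_dims)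
  also have "\<dots> = ip v (v - hadj U *\<^sub>v (U *\<^sub>v v))"
    using E v assms(2) by (simp add: F_def minus_mult_mat_vec_dims) (simp add: E_def mult_mat_vec_assoc_dims)
  also have "\<dots> = ip v v - ip v (hadj U *\<^sub>v (U *\<^sub>v v))"
    using v by (simp add: ip_def algebra_simps sum_subtractf)
  also have "ip v (hadj U *\<^sub>v (U *\<^sub>v v)) = ip (U *\<^sub>v v) (U *\<^sub>v v)"
    using ip_hadj[of v "hadj U" "U *\<^sub>v v"] v by simp
  finally have "complex_of_real ((vnorm (F *\<^sub>v v))\<^sup>2) = of_real ((vnorm v)\<^sup>2 - (vnorm (U *\<^sub>v v))\<^sup>2)"
    by (simp add: ip_self)
  then have "(vnorm (F *\<^sub>v v))\<^sup>2 = (vnorm v)\<^sup>2 - (vnorm (U *\<^sub>v v))\<^sup>2"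
    unfolding of_real_eq_iff .
  then have "(vnorm (U *\<^sub>v v))\<^sup>2 \<le> (vnorm v)\<^sup>2" by (smt (verit) zero_le_power2)
  then show ?thesis using power2_le_imp_le vnorm_nonneg by blast
qed

subsection \<open>Stable matrices and Gramians\<close>

text \<open>Geometric decay of all entries of the powers: the form in which stability enters the
  series below.\<close>

definition power_decay :: "complex mat \<Rightarrow> bool" where
  "power_decay A \<longleftrightarrow> (\<exists>c \<rho>. 0 \<le> \<rho> \<and> \<rho> < 1 \<and> (\<forall>k. norm_bound (A ^\<^sub>m k) (c * \<rho> ^ k)))"

lemma pow_smult_mat:
  assumes "(A :: complex mat) \<in> carrier_mat n n"
  shows "(c \<cdot>\<^sub>m A) ^\<^sub>m k = c ^ k \<cdot>\<^sub>m A ^\<^sub>m k"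
proof (induction k)
  case 0 then show ?case using assms by (auto intro!: eq_matI)
next
  case (Suc k)
  then have "(c \<cdot>\<^sub>m A) ^\<^sub>m Suc k = c \<cdot>\<^sub>m (c ^ k \<cdot>\<^sub>m (A ^\<^sub>m k * A))"
    using assms by (simp add: mult_smult_dims smult_mult_dims)
  also have "\<dots> = c ^ Suc k \<cdot>\<^sub>m A ^\<^sub>m Suc k" using assms by (intro eq_matI) auto
  finally show ?case .
qed

text \<open>A matrix with spectral radius below 1 has bounded powers, by its Jordan form. Applied to
  A divided by a number \<rho> < 1 that still exceeds the spectral radius of A, boundedness turns
  into decay at rate \<rho>.\<close>

lemma stable_mat_power_decay:
  assumes A: "A \<in> carrier_mat n n" and stable: "stable_mat A"
  shows "power_decay A"
proof (cases "n = 0")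
  \<comment> \<open>An empty matrix has no eigenvalues, so its spectral radius is not attained by
    any.\<close>
  case True
  then show ?thesis
    using A unfolding power_decay_def norm_bound_def by (intro exI[of _ 0]) auto
next
  case False
  let ?s = "spectral_radius A"
  have "?s \<in> norm ` spectrum A" using spectral_radius_mem_max(1)[OF A] False by simp
  then have s: "0 \<le> ?s" "?s < 1" using stable by (auto simp: spectrum_def stable_mat_def)
  \<comment> \<open>The midpoint lies strictly between the spectral radius and 1, and it is positive
    even for nilpotent A, so that dividing by it is possible.\<close>
  define \<rho> where "\<rho> = (?s + 1) / 2"
  have \<rho>: "0 < \<rho>" "\<rho> < 1" "?s < \<rho>" using s by (auto simp: \<rho>_def)
  define B where "B = complex_of_real (1 / \<rho>) \<cdot>\<^sub>m A"
  have B: "B \<in> carrier_mat n n" using A by (simp add: B_def)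
  have "spectral_radius B \<in> norm ` spectrum B" using spectral_radius_mem_max(1)[OF B] False by simp
  then obtain e v where e: "spectral_radius B = cmod e" and v: "eigenvector B v e"
    by (auto simp: spectrum_def eigenvalue_def)
  have Bv: "B *\<^sub>v v = e \<cdot>\<^sub>v v" and vc: "v \<in> carrier_vec n" "v \<noteq> 0\<^sub>v n"
    using v B by (auto simp: eigenvector_def)
  have "A = of_real \<rho> \<cdot>\<^sub>m B" using \<rho> A by (intro eq_matI) (auto simp: B_def)
  then have "A *\<^sub>v v = of_real \<rho> \<cdot>\<^sub>v (B *\<^sub>v v)" using B vc by (simp add: smult_mult_mat_vec_dims)
  then have "A *\<^sub>v v = (of_real \<rho> * e) \<cdot>\<^sub>v v" by (simp add: Bv smult_smult_assoc)
  then have "of_real \<rho> * e \<in> spectrum A"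
    using A vc by (auto simp: spectrum_def eigenvalue_def eigenvector_def)
  then have "cmod (of_real \<rho> * e) \<le> ?s" using spectral_radius_mem_max(2)[OF A] False by blast
  then have "\<rho> * cmod e \<le> ?s" using \<rho> by (simp add: norm_mult)
  then have "\<rho> * cmod e < \<rho> * 1" using \<rho> by linarith
  then have "spectral_radius B < 1" using e \<rho>(1) by (metis mult_less_cancel_left_pos)
  moreover obtain as where "char_poly B = (\<Prod>a\<leftarrow>as. [:- a, 1:])" using char_poly_factorized[OF B] by blast
  ultimately obtain c where c: "\<And>k. norm_bound (B ^\<^sub>m k) c"
    using spectral_radius_jnf_norm_bound_less_1[OF B] jordan_nf_exists[OF B] by blast
  have "norm_bound (A ^\<^sub>m k) (c * \<rho> ^ k)" for k
  proof
    fix i j assume ij: "i < dim_row (A ^\<^sub>m k)" "j < dim_col (A ^\<^sub>m k)"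
    have "cmod ((B ^\<^sub>m k) $$ (i,j)) \<le> c"
      using c[of k] ij pow_carrier_mat[OF A, of k] pow_carrier_mat[OF B, of k]
      unfolding norm_bound_def by (metis carrier_matD)
    moreover have "(B ^\<^sub>m k) $$ (i,j) = of_real ((1 / \<rho>) ^ k) * (A ^\<^sub>m k) $$ (i,j)"
      using ij A by (simp add: B_def pow_smult_mat[OF A])
    ultimately have "(1 / \<rho>) ^ k * cmod ((A ^\<^sub>m k) $$ (i,j)) \<le> c"
      using \<rho> by (simp add: norm_mult norm_divide norm_power)
    then show "cmod ((A ^\<^sub>m k) $$ (i,j)) \<le> c * \<rho> ^ k"
      using \<rho> by (simp add: field_simps power_divide)
  qed
  then show ?thesis using \<rho> unfolding power_decay_def by (intro exI[of _ c] exI[of _ \<rho>]) auto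
qed

lemma norm_bound_hadj: "norm_bound (hadj A) b \<longleftrightarrow> norm_bound A b"
  unfolding norm_bound_def by auto

lemma power_decay_hadj:
  assumes "A \<in> carrier_mat n n" "power_decay A"
  shows "power_decay (hadj A)"
  using assms(2) unfolding power_decay_def hadj_pow[OF assms(1), symmetric] norm_bound_hadj .

section \<open>Entrywise convergent series of matrices\<close>

definition msummable :: "nat \<Rightarrow> nat \<Rightarrow> (nat \<Rightarrow> complex mat) \<Rightarrow> bool" where
  "msummable a b S \<longleftrightarrow> (\<forall>\<nu>. S \<nu> \<in> carrier_mat a b) \<and> (\<forall>i<a. \<forall>j<b. summable (\<lambda>\<nu>. S \<nu> $$ (i,j)))"

lemma msuminf_carrier [simp]: "msuminf a b S \<in> carrier_mat a b"
  by (simp add: msuminf_def)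

lemma dim_msuminf [simp]: "dim_row (msuminf a b S) = a" "dim_col (msuminf a b S) = b"
  by (simp_all add: msuminf_def)

lemma index_msuminf [simp]: "i < a \<Longrightarrow> j < b \<Longrightarrow> msuminf a b S $$ (i,j) = (\<Sum>\<nu>. S \<nu> $$ (i,j))"
  by (simp add: msuminf_def)

lemma index_mult_mat_sum:
  "i < dim_row A \<Longrightarrow> j < dim_col B \<Longrightarrow> dim_col A = dim_row B \<Longrightarrow>
    ((A :: complex mat) * B) $$ (i,j) = (\<Sum>l<dim_row B. A $$ (i,l) * B $$ (l,j))"
  by (simp add: scalar_prod_def atLeast0LessThan)

lemma msuminf_mult_left:
  assumes S: "msummable a b S" and X: "X \<in> carrier_mat k a"
  shows "msummable k b (\<lambda>\<nu>. X * S \<nu>)" "msuminf k b (\<lambda>\<nu>. X * S \<nu>) = X * msuminf a b S"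
proof -
  have dS: "dim_row (S \<nu>) = a" "dim_col (S \<nu>) = b" for \<nu> using S by (auto simp: msummable_def)
  have sm: "summable (\<lambda>\<nu>. X $$ (i,l) * S \<nu> $$ (l,j))" if "l < a" "j < b" for i l j
    using S that by (auto simp: msummable_def intro: summable_mult)
  show "msummable k b (\<lambda>\<nu>. X * S \<nu>)"
    using sm X dS S by (auto simp: msummable_def index_mult_mat_sum simp del: index_mult_mat(1) intro!: summable_sum mult_carrier_mat[of _ k a])
  show "msuminf k b (\<lambda>\<nu>. X * S \<nu>) = X * msuminf a b S"
  proof (rule eq_matI)
    fix i j assume "i < dim_row (X * msuminf a b S)" "j < dim_col (X * msuminf a b S)"
    then have ij: "i < k" "j < b" using X by auto
    have "msuminf k b (\<lambda>\<nu>. X * S \<nu>) $$ (i,j) = (\<Sum>\<nu>. \<Sum>l<a. X $$ (i,l) * S \<nu> $$ (l,j))"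
      using ij X dS by (simp add: index_mult_mat_sum del: index_mult_mat(1))
    also have "\<dots> = (\<Sum>l<a. \<Sum>\<nu>. X $$ (i,l) * S \<nu> $$ (l,j))"
      using sm ij by (intro suminf_sum) auto
    also have "\<dots> = (\<Sum>l<a. X $$ (i,l) * (\<Sum>\<nu>. S \<nu> $$ (l,j)))"
      using S ij by (intro sum.cong refl suminf_mult) (auto simp: msummable_def)
    also have "\<dots> = (X * msuminf a b S) $$ (i,j)"
      using ij X by (simp add: index_mult_mat_sum del: index_mult_mat(1))
    finally show "msuminf k b (\<lambda>\<nu>. X * S \<nu>) $$ (i,j) = (X * msuminf a b S) $$ (i,j)" .
  qed (use X in auto)
qed

lemma msuminf_mult_right:
  assumes S: "msummable a b S" and X: "X \<in> carrier_mat b k"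
  shows "msummable a k (\<lambda>\<nu>. S \<nu> * X)" "msuminf a k (\<lambda>\<nu>. S \<nu> * X) = msuminf a b S * X"
proof -
  have dS: "dim_row (S \<nu>) = a" "dim_col (S \<nu>) = b" for \<nu> using S by (auto simp: msummable_def)
  have sm: "summable (\<lambda>\<nu>. S \<nu> $$ (i,l) * X $$ (l,j))" if "i < a" "l < b" for i l j
    using S that by (auto simp: msummable_def intro: summable_mult2)
  show "msummable a k (\<lambda>\<nu>. S \<nu> * X)"
    using sm X dS S by (auto simp: msummable_def index_mult_mat_sum simp del: index_mult_mat(1) intro!: summable_sum mult_carrier_mat[of _ a b])
  show "msuminf a k (\<lambda>\<nu>. S \<nu> * X) = msuminf a b S * X"
  proof (rule eq_matI)
    fix i j assume "i < dim_row (msuminf a b S * X)" "j < dim_col (msuminf a b S * X)"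
    then have ij: "i < a" "j < k" using X by auto
    have "msuminf a k (\<lambda>\<nu>. S \<nu> * X) $$ (i,j) = (\<Sum>\<nu>. \<Sum>l<b. S \<nu> $$ (i,l) * X $$ (l,j))"
      using ij X dS by (simp add: index_mult_mat_sum del: index_mult_mat(1))
    also have "\<dots> = (\<Sum>l<b. \<Sum>\<nu>. S \<nu> $$ (i,l) * X $$ (l,j))"
      using sm ij by (intro suminf_sum) auto
    also have "\<dots> = (\<Sum>l<b. (\<Sum>\<nu>. S \<nu> $$ (i,l)) * X $$ (l,j))"
      using S ij by (intro sum.cong refl suminf_mult2[symmetric]) (auto simp: msummable_def)
    also have "\<dots> = (msuminf a b S * X) $$ (i,j)"
      using ij X by (simp add: index_mult_mat_sum del: index_mult_mat(1))
    finally show "msuminf a k (\<lambda>\<nu>. S \<nu> * X) $$ (i,j) = (msuminf a b S * X) $$ (i,j)" .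
  qed (use X in auto)
qed

lemma msuminf_split_head:
  assumes "msummable a b S"
  shows "msuminf a b S = S 0 + msuminf a b (\<lambda>\<nu>. S (Suc \<nu>))"
proof (rule eq_matI)
  fix i j
  assume "i < dim_row (S 0 + msuminf a b (\<lambda>\<nu>. S (Suc \<nu>)))" "j < dim_col (S 0 + msuminf a b (\<lambda>\<nu>. S (Suc \<nu>)))"
  then have ij: "i < a" "j < b" by auto
  then show "msuminf a b S $$ (i,j) = (S 0 + msuminf a b (\<lambda>\<nu>. S (Suc \<nu>))) $$ (i,j)"
    using assms suminf_split_head[of "\<lambda>\<nu>. S \<nu> $$ (i,j)"] by (simp add: msummable_def)
qed (use assms in \<open>auto simp: msummable_def\<close>)

lemma msummable_geometric:
  assumes "\<And>\<nu>. S \<nu> \<in> carrier_mat a b" "0 \<le> \<rho>" "\<rho> < 1" "\<And>\<nu>. norm_bound (S \<nu>) (c * \<rho> ^ \<nu>)"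
  shows "msummable a b S"
  unfolding msummable_def
proof (intro conjI allI impI)
  fix i j assume ij: "i < a" "j < b"
  show "summable (\<lambda>\<nu>. S \<nu> $$ (i,j))"
  proof (rule summable_comparison_test')
    show "summable (\<lambda>\<nu>. c * \<rho> ^ \<nu>)" using assms by (intro summable_mult summable_geometric) auto
    show "norm (S \<nu> $$ (i,j)) \<le> c * \<rho> ^ \<nu>" if "0 \<le> \<nu>" for \<nu>
      using assms(4)[of \<nu>] ij assms(1)[of \<nu>] unfolding norm_bound_def by auto
  qed
qed (use assms in auto)

section \<open>Gramians and their Stein equations\<close>

lemma msummable_gramian:
  assumes A: "A \<in> carrier_mat n n" "power_decay A" and B: "B \<in> carrier_mat n k"
  shows "msummable n n (\<lambda>\<nu>. A ^\<^sub>m \<nu> * B * hadj B * hadj A ^\<^sub>m \<nu>)"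
proof -
  from A(2) obtain c \<rho> where \<rho>: "0 \<le> \<rho>" "\<rho> < 1" and bd: "\<And>k. norm_bound (A ^\<^sub>m k) (c * \<rho> ^ k)"
    by (auto simp: power_decay_def)
  obtain b where b: "norm_bound (B * hadj B) b" using norm_bound_max by blast
  have BB: "B * hadj B \<in> carrier_mat n n" using B by auto
  show ?thesis
  proof (rule msummable_geometric)
    fix \<nu>
    have P: "A ^\<^sub>m \<nu> \<in> carrier_mat n n" "hadj (A ^\<^sub>m \<nu>) \<in> carrier_mat n n" using A by auto
    have eq: "A ^\<^sub>m \<nu> * B * hadj B * hadj A ^\<^sub>m \<nu> = A ^\<^sub>m \<nu> * (B * hadj B) * hadj (A ^\<^sub>m \<nu>)"
      using A B by (simp add: mult_assoc_dims hadj_pow)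
    show "A ^\<^sub>m \<nu> * B * hadj B * hadj A ^\<^sub>m \<nu> \<in> carrier_mat n n"
      unfolding eq by (rule mult_carrier_mat[OF mult_carrier_mat[OF P(1) BB] P(2)])
    have "norm_bound (A ^\<^sub>m \<nu> * (B * hadj B) * hadj (A ^\<^sub>m \<nu>))
        (c * \<rho> ^ \<nu> * b * of_nat n * (c * \<rho> ^ \<nu>) * of_nat n)"
      using norm_bound_mult[OF P(1) BB bd b] bd P BB
      by (intro norm_bound_mult[OF mult_carrier_mat[OF P(1) BB] P(2)]) (auto simp: norm_bound_hadj)
    \<comment> \<open>Each of the two outer powers contributes one factor
      \<open>\<rho> ^ \<nu>\<close>, and each of the two matrix products one factor n.\<close>
    also have "c * \<rho> ^ \<nu> * b * of_nat n * (c * \<rho> ^ \<nu>) * of_nat n = (c * c * b * of_nat n * of_nat n) * (\<rho> * \<rho>) ^ \<nu>"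
      by (simp add: power_mult_distrib)
    finally show "norm_bound (A ^\<^sub>m \<nu> * B * hadj B * hadj A ^\<^sub>m \<nu>) ((c * c * b * of_nat n * of_nat n) * (\<rho> * \<rho>) ^ \<nu>)"
      unfolding eq .
    show "0 \<le> \<rho> * \<rho>" "\<rho> * \<rho> < 1" using \<rho> mult_left_le[of \<rho> \<rho>] by auto
  qed
qed

lemma ctrl_gram_carrier:
  "A \<in> carrier_mat n n \<Longrightarrow> ctrl_gram A B \<in> carrier_mat n n"
  by (simp add: ctrl_gram_def)

text \<open>After the term \<nu> = 0 is split off, A and its adjoint can be pulled out of the
  remaining series on the two sides.\<close>

lemma ctrl_gram_stein:
  assumes A: "A \<in> carrier_mat n n" "power_decay A" and B: "B \<in> carrier_mat n k"
  shows "ctrl_gram A B = B * hadj B + A * ctrl_gram A B * hadj A"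
proof -
  let ?S = "\<lambda>\<nu>. A ^\<^sub>m \<nu> * B * hadj B * hadj A ^\<^sub>m \<nu>"
  note S = msummable_gramian[OF assms]
  have P: "ctrl_gram A B = msuminf n n ?S" using A by (simp add: ctrl_gram_def)
  have Suc: "?S (Suc \<nu>) = A * ?S \<nu> * hadj A" for \<nu>
    using A B by (subst pow_mat_Suc_left[OF A(1)]) (simp add: mult_assoc_dims)
  have "msuminf n n (\<lambda>\<nu>. A * ?S \<nu> * hadj A) = A * msuminf n n ?S * hadj A"
    using msuminf_mult_left[OF S A(1)] A
    by (subst msuminf_mult_right[of n n]) auto
  then show ?thesis
    unfolding P using msuminf_split_head[OF S] unfolding Suc using A B by simp
qed

lemma ctrl_gram_psd:
  assumes A: "A \<in> carrier_mat n n" "power_decay A" and B: "B \<in> carrier_mat n k"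
  shows "psd (ctrl_gram A B)"
proof -
  let ?S = "\<lambda>\<nu>. A ^\<^sub>m \<nu> * B * hadj B * hadj A ^\<^sub>m \<nu>"
  note S = msummable_gramian[OF assms]
  have P: "ctrl_gram A B = msuminf n n ?S" using A by (simp add: ctrl_gram_def)
  have eq: "?S \<nu> = (A ^\<^sub>m \<nu> * B) * hadj (A ^\<^sub>m \<nu> * B)" for \<nu>
    using A B by (simp add: mult_assoc_dims hadj_mult hadj_pow)
  show ?thesis
    unfolding psd_iff
  proof (intro conjI ballI)
    show "ctrl_gram A B \<in> carrier_mat (dim_row (ctrl_gram A B)) (dim_row (ctrl_gram A B))"
      unfolding P by simp
    show "hadj (ctrl_gram A B) = ctrl_gram A B"
    proof (rule eq_matI)
      fix i j assume "i < dim_row (ctrl_gram A B)" "j < dim_col (ctrl_gram A B)"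
      then have ij: "i < n" "j < n" by (auto simp: P)
      have "hadj (?S \<nu>) = ?S \<nu>" for \<nu> unfolding eq using A B by (simp add: hadj_mult)
      then have "cnj (?S \<nu> $$ (j,i)) = ?S \<nu> $$ (i,j)" for \<nu>
        using index_hadj[of i "?S \<nu>" j] ij A by simp
      moreover have "cnj (\<Sum>\<nu>. ?S \<nu> $$ (j,i)) = (\<Sum>\<nu>. cnj (?S \<nu> $$ (j,i)))"
        using S ij by (intro bounded_linear.suminf[OF bounded_linear_cnj]) (auto simp: msummable_def)
      ultimately show "hadj (ctrl_gram A B) $$ (i,j) = ctrl_gram A B $$ (i,j)"
        unfolding P using ij by simp
    qed (auto simp: P)
    fix v :: "complex vec" assume "v \<in> carrier_vec (dim_row (ctrl_gram A B))"
    then have v: "dim_vec v = n" by (auto simp: P)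
    \<comment> \<open>As a one-column matrix, v turns the quadratic form into an entry of a matrix
      product, and the laws for series of matrices apply to it.\<close>
    define V where "V = mat n 1 (\<lambda>(i,_). v $ i)"
    have V: "V \<in> carrier_mat n 1" by (simp add: V_def)
    have ipV: "(hadj V * M * V) $$ (0,0) = ip v (M *\<^sub>v v)" if "M \<in> carrier_mat n n" for M
    proof -
      have "(hadj V * M * V) $$ (0,0) = (hadj V * (M * V)) $$ (0,0)"
        using that V by (simp add: mult_assoc_dims)
      also have "\<dots> = (\<Sum>l<n. cnj (v $ l) * (M * V) $$ (l,0))"
        using that V by (subst index_mult_mat_sum) (auto simp: V_def)
      also have "\<dots> = ip v (M *\<^sub>v v)"
        unfolding ip_def using that v
        by (auto intro!: sum.cong simp: V_def scalar_prod_def)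
      finally show ?thesis .
    qed
    have "msummable 1 1 (\<lambda>\<nu>. hadj V * ?S \<nu> * V)" "msuminf 1 1 (\<lambda>\<nu>. hadj V * ?S \<nu> * V) = hadj V * ctrl_gram A B * V"
      using msuminf_mult_left[OF S, of "hadj V" 1] V msuminf_mult_right[of 1 n "\<lambda>\<nu>. hadj V * ?S \<nu>" V 1]
      by (auto simp: P)
    then have "ip v (ctrl_gram A B *\<^sub>v v) = (\<Sum>\<nu>. (hadj V * ?S \<nu> * V) $$ (0,0))"
      and sm: "summable (\<lambda>\<nu>. (hadj V * ?S \<nu> * V) $$ (0,0))"
      using ipV[of "ctrl_gram A B", symmetric] index_msuminf[of 0 1 0 1 "\<lambda>\<nu>. hadj V * ?S \<nu> * V"]
      by (auto simp: P msummable_def)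
    then have "Re (ip v (ctrl_gram A B *\<^sub>v v)) = (\<Sum>\<nu>. Re ((hadj V * ?S \<nu> * V) $$ (0,0)))"
      using bounded_linear.suminf[OF bounded_linear_Re sm] by simp
    also have "0 \<le> \<dots>"
    proof (rule suminf_nonneg)
      show "summable (\<lambda>\<nu>. Re ((hadj V * ?S \<nu> * V) $$ (0,0)))"
        by (rule bounded_linear.summable[OF bounded_linear_Re sm])
      fix \<nu>
      let ?X = "A ^\<^sub>m \<nu> * B"
      have "(hadj V * ?S \<nu> * V) $$ (0,0) = ip v (?S \<nu> *\<^sub>v v)"
        using S by (intro ipV) (auto simp: msummable_def)
      also have "\<dots> = ip v (?X *\<^sub>v (hadj ?X *\<^sub>v v))"
        unfolding eq using A B v by (subst mult_mat_vec_assoc_dims) auto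
      also have "\<dots> = ip (hadj ?X *\<^sub>v v) (hadj ?X *\<^sub>v v)"
        using A B v by (subst ip_hadj) auto
      finally show "0 \<le> Re ((hadj V * ?S \<nu> * V) $$ (0,0))" by (simp add: ip_self)
    qed
    finally show "0 \<le> Re (ip v (ctrl_gram A B *\<^sub>v v))" .
  qed
qed

text \<open>Duality: convergence, positivity and the Stein equation of \<open>Y\<close> are those of
  a controllability Gramian.\<close>

lemma obs_gram_eq_ctrl_gram:
  assumes "A \<in> carrier_mat n n"
  shows "obs_gram C A = ctrl_gram (hadj A) (hadj C)"
  using assms by (simp add: obs_gram_def ctrl_gram_def)

text \<open>By the Stein equation the form at w is the squared norm of C w plus the form at A w.
  Both terms are nonnegative, so a zero at v propagates to all A^k v and forces C A^k v = 0, whence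
  observability applies.\<close>

lemma obs_gram_definite:
  assumes A: "A \<in> carrier_mat n n" "power_decay A" and C: "C \<in> carrier_mat m n"
    and obs: "observable C A" and v: "v \<in> carrier_vec n" "ip v (obs_gram C A *\<^sub>v v) = 0"
  shows "v = 0\<^sub>v n"
proof -
  define Y where "Y = obs_gram C A"
  have A': "hadj A \<in> carrier_mat n n" "power_decay (hadj A)" "hadj C \<in> carrier_mat n m"
    using A C power_decay_hadj by auto
  have Y: "Y \<in> carrier_mat n n" "psd Y" "Y = hadj C * C + hadj A * Y * A"
    unfolding Y_def obs_gram_eq_ctrl_gram[OF A(1)]
    by (rule ctrl_gram_carrier[OF A'(1)], rule ctrl_gram_psd[OF A'],
        rule ctrl_gram_stein[OF A', unfolded hadj_hadj])
  have step: "C *\<^sub>v w = 0\<^sub>v m \<and> Re (ip (A *\<^sub>v w) (Y *\<^sub>v (A *\<^sub>v w))) = 0"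
    if w: "w \<in> carrier_vec n" "Re (ip w (Y *\<^sub>v w)) = 0" for w
  proof -
    have d: "dim_vec w = n" "dim_row A = n" "dim_col A = n" "dim_row C = m" "dim_col C = n" "dim_row Y = n" "dim_col Y = n"
      using A C Y w by auto
    have "ip w (Y *\<^sub>v w) = ip w ((hadj C * C + hadj A * Y * A) *\<^sub>v w)" 
      by (rule arg_cong[OF Y(3), of "\<lambda>M. ip w (M *\<^sub>v w)"])
    also have "\<dots> = ip w (hadj C *\<^sub>v (C *\<^sub>v w)) + ip w (hadj A *\<^sub>v (Y *\<^sub>v (A *\<^sub>v w)))"
      using d by (simp add: add_mult_mat_vec_dims mult_mat_vec_assoc_dims)
        (simp add: ip_def sum.distrib algebra_simps)
    also have "\<dots> = ip (C *\<^sub>v w) (C *\<^sub>v w) + ip (A *\<^sub>v w) (Y *\<^sub>v (A *\<^sub>v w))"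
      using d ip_hadj[of w "hadj C"] ip_hadj[of w "hadj A"] by simp
    finally have "(vnorm (C *\<^sub>v w))\<^sup>2 + Re (ip (A *\<^sub>v w) (Y *\<^sub>v (A *\<^sub>v w))) = 0"
      using w(2) by (simp add: ip_self)
    moreover have "0 \<le> Re (ip (A *\<^sub>v w) (Y *\<^sub>v (A *\<^sub>v w)))"
      using Y A w by (auto simp: psd_iff)
    ultimately have "(vnorm (C *\<^sub>v w))\<^sup>2 = 0" "Re (ip (A *\<^sub>v w) (Y *\<^sub>v (A *\<^sub>v w))) = 0"
      by (smt (verit) zero_le_power2)+
    then show ?thesis using d by (simp add: vnorm_eq_0_iff)
  qed
  have vk: "A ^\<^sub>m k *\<^sub>v v \<in> carrier_vec n" for k
    using A(1) by (intro carrier_vecI) simp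
  have Ak: "Re (ip (A ^\<^sub>m k *\<^sub>v v) (Y *\<^sub>v (A ^\<^sub>m k *\<^sub>v v))) = 0" for k
  proof (induction k)
    case 0 then show ?case using v A by (simp add: Y_def)
  next
    case (Suc k)
    have eq: "A ^\<^sub>m Suc k *\<^sub>v v = A *\<^sub>v (A ^\<^sub>m k *\<^sub>v v)"
      unfolding pow_mat_Suc_left[OF A(1)] using A(1) v(1) by (intro mult_mat_vec_assoc_dims) auto
    show ?case unfolding eq using step[OF vk Suc.IH] by blast
  qed
  have "(C * A ^\<^sub>m k) *\<^sub>v v = 0\<^sub>v m" for k
    using step[OF vk Ak[of k]] A(1) C v(1) by (subst mult_mat_vec_assoc_dims) auto
  then show ?thesis using obs v A C by (auto simp: observable_def)
qed

subsection \<open>Transfer functions\<close>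

lemma minv_eqI:
  assumes M: "M \<in> carrier_mat n n" and N: "N \<in> carrier_mat n n" and MN: "M * N = 1\<^sub>m n"
  shows "minv M = N"
  unfolding minv_def
proof (rule the_equality)
  have "N * M = 1\<^sub>m n" by (rule mat_mult_left_right_inverse[OF M N MN])
  then show "N \<in> carrier_mat (dim_row M) (dim_row M) \<and> N * M = 1\<^sub>m (dim_row M) \<and> M * N = 1\<^sub>m (dim_row M)"
    using M N MN by auto
  fix N' assume "N' \<in> carrier_mat (dim_row M) (dim_row M) \<and> N' * M = 1\<^sub>m (dim_row M) \<and> M * N' = 1\<^sub>m (dim_row M)"
  then have N': "N' \<in> carrier_mat n n" "N' * M = 1\<^sub>m n" using M by auto
  have "N' = N' * (M * N)" using N' MN by simp
  also have "\<dots> = N' * M * N" using N' M N by (intro mult_assoc_dims[symmetric]) auto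
  also have "\<dots> = N" using N' N by simp
  finally show "N' = N" .
qed

section \<open>Neumann series and Taylor coefficients\<close>

lemma neumann_series:
  assumes A: "A \<in> carrier_mat n n" "power_decay A" and z: "cmod z < 1"
  defines "S \<equiv> \<lambda>k. z ^ k \<cdot>\<^sub>m A ^\<^sub>m k"
  shows "msummable n n S" "(1\<^sub>m n - z \<cdot>\<^sub>m A) * msuminf n n S = 1\<^sub>m n"
    "minv (1\<^sub>m n - z \<cdot>\<^sub>m A) = msuminf n n S"
proof -
  from A(2) obtain c \<rho> where \<rho>: "0 \<le> \<rho>" "\<rho> < 1" and bd: "\<And>k. norm_bound (A ^\<^sub>m k) (c * \<rho> ^ k)"
    by (auto simp: power_decay_def)
  show S: "msummable n n S"
  proof (rule msummable_geometric[OF _ \<rho>])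
    fix k
    show "S k \<in> carrier_mat n n" using A by (simp add: S_def)
    show "norm_bound (S k) (c * \<rho> ^ k)"
    proof
      fix i j assume ij: "i < dim_row (S k)" "j < dim_col (S k)"
      have "norm (S k $$ (i,j)) = cmod z ^ k * cmod ((A ^\<^sub>m k) $$ (i,j))"
        using ij by (simp add: S_def norm_mult norm_power)
      also have "\<dots> \<le> 1 * (c * \<rho> ^ k)"
        using bd[of k] ij z by (intro mult_mono power_le_one) (auto simp: norm_bound_def S_def)
      finally show "norm (S k $$ (i,j)) \<le> c * \<rho> ^ k" by simp
    qed
  qed
  let ?R = "msuminf n n S"
  have S0: "S 0 = 1\<^sub>m n" using A(1) by (auto simp: S_def intro!: eq_matI)
  have SSuc: "S (Suc k) = (z \<cdot>\<^sub>m A) * S k" for k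
    unfolding S_def pow_mat_Suc_left[OF A(1)] using A(1)
    by (simp add: mult_smult_dims smult_mult_dims) (auto intro!: eq_matI)
  have "msuminf n n (\<lambda>k. S (Suc k)) = (z \<cdot>\<^sub>m A) * ?R"
    unfolding SSuc using A(1) by (intro msuminf_mult_left(2)[OF S]) auto
  then have R: "?R = 1\<^sub>m n + (z \<cdot>\<^sub>m A) * ?R"
    using msuminf_split_head[OF S] unfolding S0 by metis
  show inv: "(1\<^sub>m n - z \<cdot>\<^sub>m A) * ?R = 1\<^sub>m n"
  proof -
    have "(1\<^sub>m n - z \<cdot>\<^sub>m A) * ?R = ?R - (z \<cdot>\<^sub>m A) * ?R"
      using A(1) by (subst minus_mult_distrib_dims) auto
    also have "\<dots> = (1\<^sub>m n + (z \<cdot>\<^sub>m A) * ?R) - (z \<cdot>\<^sub>m A) * ?R"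
      by (rule arg_cong[OF R, of "\<lambda>M. M - (z \<cdot>\<^sub>m A) * ?R"])
    also have "\<dots> = 1\<^sub>m n" using A(1) by (intro eq_matI) auto
    finally show ?thesis .
  qed
  show "minv (1\<^sub>m n - z \<cdot>\<^sub>m A) = ?R"
    by (rule minv_eqI[OF _ _ inv]) (use A in auto)
qed

text \<open>The factor z in front of the resolvent moves the Neumann coefficients up by one place; D
  fills place 0.\<close>

lemma tf_sums:
  assumes dims: "A \<in> carrier_mat n n" "C \<in> carrier_mat m n" "B \<in> carrier_mat n k" "D \<in> carrier_mat m k"
    and A: "power_decay A" and z: "cmod z < 1" and ab: "a < m" "b < k"
  shows "(\<lambda>j. (case j of 0 \<Rightarrow> D | Suc i \<Rightarrow> C * A ^\<^sub>m i * B) $$ (a,b) * z ^ j) sums (tf D C A B z $$ (a,b))"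
proof -
  let ?S = "\<lambda>k. z ^ k \<cdot>\<^sub>m A ^\<^sub>m k"
  note N = neumann_series[OF dims(1) A z]
  have T: "msummable m k (\<lambda>j. C * ?S j * B)" "msuminf m k (\<lambda>j. C * ?S j * B) = C * msuminf n n ?S * B"
    using msuminf_mult_left[OF N(1) dims(2)] msuminf_mult_right[of m n "\<lambda>j. C * ?S j" B k] dims(3) by auto
  have tf: "tf D C A B z $$ (a,b) = D $$ (a,b) + z * (\<Sum>j. (C * ?S j * B) $$ (a,b))"
    using dims ab T(2) index_msuminf[OF ab, of "\<lambda>j. C * ?S j * B"]
    by (simp add: tf_def N(3) del: index_mult_mat(1))
  have eq: "(C * ?S j * B) $$ (a,b) = (C * A ^\<^sub>m j * B) $$ (a,b) * z ^ j" for j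
  proof -
    have "C * ?S j * B = z ^ j \<cdot>\<^sub>m (C * A ^\<^sub>m j * B)"
      using dims by (simp add: mult_smult_dims smult_mult_dims)
    then show ?thesis using ab dims by (simp del: index_mult_mat(1))
  qed
  have "(\<lambda>j. (C * ?S j * B) $$ (a,b)) sums (\<Sum>j. (C * ?S j * B) $$ (a,b))"
    using T(1) ab by (auto simp: msummable_def intro: summable_sums)
  then have "(\<lambda>j. z * (C * ?S j * B) $$ (a,b)) sums (z * (\<Sum>j. (C * ?S j * B) $$ (a,b)))"
    by (rule sums_mult)
  then have "(\<lambda>j. (C * A ^\<^sub>m j * B) $$ (a,b) * z ^ Suc j) sums (z * (\<Sum>j. (C * ?S j * B) $$ (a,b)))"
    unfolding eq by (simp add: mult_ac del: index_mult_mat(1))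
  then have "(\<lambda>j. (case Suc j of 0 \<Rightarrow> D | Suc i \<Rightarrow> C * A ^\<^sub>m i * B) $$ (a,b) * z ^ Suc j) sums
      (z * (\<Sum>j. (C * ?S j * B) $$ (a,b)))"
    by (simp del: index_mult_mat(1))
  from sums_Suc[OF this] show ?thesis
    unfolding tf by (simp add: add.commute del: index_mult_mat(1))
qed

text \<open>A power series expansion near 0 determines the iterated derivatives there, so the Taylor
  coefficients are obtained without differentiating the resolvent.\<close>

lemma taylor_coeff_tf:
  assumes dims: "A \<in> carrier_mat n n" "C \<in> carrier_mat m n" "B \<in> carrier_mat n k" "D \<in> carrier_mat m k"
    and A: "power_decay A"
  shows "taylor_coeff m k (tf D C A B) j = (case j of 0 \<Rightarrow> D | Suc i \<Rightarrow> C * A ^\<^sub>m i * B)"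
    (is "_ = ?c j")
proof (rule eq_matI)
  have c: "?c j \<in> carrier_mat m k" using dims by (auto split: nat.splits intro!: carrier_matI)
  fix a b assume "a < dim_row (?c j)" "b < dim_col (?c j)"
  then have ab: "a < m" "b < k" using c by auto
  have "(\<lambda>z. tf D C A B z $$ (a,b)) has_fps_expansion Abs_fps (\<lambda>j. ?c j $$ (a,b))"
  proof (rule has_fps_expansionI)
    have "eventually (\<lambda>z. z \<in> ball (0::complex) 1) (nhds 0)"
      by (rule eventually_nhds_in_open) auto
    then show "eventually (\<lambda>z. (\<lambda>j. fps_nth (Abs_fps (\<lambda>j. ?c j $$ (a,b))) j * z ^ j) sums tf D C A B z $$ (a,b)) (nhds 0)"
      by eventually_elim (use tf_sums[OF dims A _ ab] in simp)
  qed
  from fps_nth_fps_expansion[OF this, of j]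
  show "taylor_coeff m k (tf D C A B) j $$ (a,b) = ?c j $$ (a,b)"
    using ab by (simp add: taylor_coeff_def del: index_mult_mat(1))
qed (use dims in \<open>auto simp: taylor_coeff_def split: nat.splits\<close>)

text \<open>In block column 0 the limit \<open>min i 0\<close> leaves the single term k = 0.\<close>

lemma toeplitz_prod_block_0:
  "toeplitz_prod_block f g i 0 = f i * hadj (g 0) + 0\<^sub>m (dim_row (f 0)) (dim_row (g 0))"
  by (simp add: toeplitz_prod_block_def)

lemma observable_cancel:
  assumes "A \<in> carrier_mat n n" "C \<in> carrier_mat m n" "X \<in> carrier_mat n k"
    and obs: "observable C A" and zero: "\<And>j. C * A ^\<^sub>m j * X = 0\<^sub>m m k"
  shows "X = 0\<^sub>m n k"
proof (rule mat_eq_zero_of_mult_vec[OF assms(3)])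
  fix v :: "complex vec" assume v: "v \<in> carrier_vec k"
  have "(C * A ^\<^sub>m j) *\<^sub>v (X *\<^sub>v v) = 0\<^sub>v m" for j
  proof -
    have "(C * A ^\<^sub>m j) *\<^sub>v (X *\<^sub>v v) = (C * A ^\<^sub>m j * X) *\<^sub>v v"
      using assms v by (intro mult_mat_vec_assoc_dims[symmetric]) auto
    also have "\<dots> = 0\<^sub>v m" unfolding zero using v by auto
    finally show ?thesis .
  qed
  moreover have "X *\<^sub>v v \<in> carrier_vec n" using assms(3) by (auto intro!: carrier_vecI)
  ultimately show "X *\<^sub>v v = 0\<^sub>v n" using obs assms(1,2) by (auto simp: observable_def)
qed

section \<open>Rationality of resolvents and transfer functions\<close>

lemma minv_eq_adj_mat:
  assumes M: "M \<in> carrier_mat n n" and d: "det M \<noteq> 0"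
  shows "minv M = inverse (det M) \<cdot>\<^sub>m adj_mat M"
proof (rule minv_eqI[OF M])
  show "inverse (det M) \<cdot>\<^sub>m adj_mat M \<in> carrier_mat n n" using adj_mat(1)[OF M] by simp
  show "M * (inverse (det M) \<cdot>\<^sub>m adj_mat M) = 1\<^sub>m n"
    using adj_mat(1,2)[OF M] M d by (simp add: mult_smult_dims) (auto intro!: eq_matI)
qed

lemma minv_properties:
  assumes M: "M \<in> carrier_mat n n" and d: "det M \<noteq> 0"
  shows "minv M \<in> carrier_mat n n" "M * minv M = 1\<^sub>m n" "minv M * M = 1\<^sub>m n"
  unfolding minv_eq_adj_mat[OF M d]
  using adj_mat[OF M] M d by (simp_all add: mult_smult_dims smult_mult_dims) (auto intro!: eq_matI)

lemma adj_mat_hom: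
  assumes "comm_ring_hom h" "A \<in> carrier_mat n n" "i < n" "j < n"
  shows "adj_mat (map_mat h A) $$ (i,j) = h (adj_mat A $$ (i,j))"
proof -
  interpret comm_ring_hom h by fact
  have "mat_delete (map_mat h A) j i = map_mat h (mat_delete A j i)"
    using assms by (intro eq_matI) (auto simp: mat_delete_def)
  then show ?thesis
    using assms by (simp add: adj_mat_def cofactor_def hom_distribs)
qed

text \<open>I - z \<alpha> is the value at z of a matrix of linear polynomials, and determinant and
  adjugate commute with the evaluation homomorphism.\<close>

lemma resolvent_polynomials:
  fixes \<alpha> :: "complex mat"
  assumes "\<alpha> \<in> carrier_mat n n"
  obtains d Q where "\<And>z. det (1\<^sub>m n - z \<cdot>\<^sub>m \<alpha>) = poly d z"
    "\<And>z i j. i < n \<Longrightarrow> j < n \<Longrightarrow> adj_mat (1\<^sub>m n - z \<cdot>\<^sub>m \<alpha>) $$ (i,j) = poly (Q i j) z"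
proof -
  define M where "M = mat n n (\<lambda>(i,j). [:if i = j then 1 else 0, - \<alpha> $$ (i,j):])"
  have M: "M \<in> carrier_mat n n" by (simp add: M_def)
  have hom: "comm_ring_hom (\<lambda>p. poly p z)" for z :: complex by unfold_locales auto
  have map: "1\<^sub>m n - z \<cdot>\<^sub>m \<alpha> = map_mat (\<lambda>p. poly p z) M" for z
    using assms by (intro eq_matI) (auto simp: M_def)
  show ?thesis
  proof
    show "det (1\<^sub>m n - z \<cdot>\<^sub>m \<alpha>) = poly (det M) z" for z
      unfolding map by (rule comm_ring_hom.hom_det[OF hom])
    show "adj_mat (1\<^sub>m n - z \<cdot>\<^sub>m \<alpha>) $$ (i,j) = poly (adj_mat M $$ (i,j)) z" if "i < n" "j < n" for z i j
      unfolding map by (rule adj_mat_hom[OF hom M that])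
  qed
qed

lemma tf_rational:
  assumes dims: "\<alpha> \<in> carrier_mat n n" "\<beta> \<in> carrier_mat n k" "\<gamma> \<in> carrier_mat p n" "\<delta> \<in> carrier_mat p k"
  obtains d P where "\<And>z. det (1\<^sub>m n - z \<cdot>\<^sub>m \<alpha>) = poly d z"
    "\<And>z a b. a < p \<Longrightarrow> b < k \<Longrightarrow> poly d z \<noteq> 0 \<Longrightarrow> tf \<delta> \<gamma> \<alpha> \<beta> z $$ (a,b) = poly (P a b) z / poly d z"
proof -
  from resolvent_polynomials[OF dims(1)] obtain d Q
    where d: "\<And>z. det (1\<^sub>m n - z \<cdot>\<^sub>m \<alpha>) = poly d z"
      and Q: "\<And>z i j. i < n \<Longrightarrow> j < n \<Longrightarrow> adj_mat (1\<^sub>m n - z \<cdot>\<^sub>m \<alpha>) $$ (i,j) = poly (Q i j) z" by blast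
  \<comment> \<open>\<open>[:0,1:]\<close> is the polynomial z. The double sum is the entry of
    \<gamma> adj(I - z \<alpha>) \<beta>, and the first summand brings \<delta> over the common
    denominator d.\<close>
  define P where "P a b = Polynomial.smult (\<delta> $$ (a,b)) d
    + [:0,1:] * (\<Sum>l<n. (\<Sum>i<n. Polynomial.smult (\<gamma> $$ (a,i)) (Q i l)) * [:\<beta> $$ (l,b):])" for a b
  show ?thesis
  proof (rule that[OF d])
    fix z a b assume ab: "a < p" "b < k" and nz: "poly d z \<noteq> 0"
    let ?M = "1\<^sub>m n - z \<cdot>\<^sub>m \<alpha>"
    have M: "?M \<in> carrier_mat n n" using dims by auto
    have adj: "adj_mat ?M \<in> carrier_mat n n" by (rule adj_mat(1)[OF M])
    have "(\<gamma> * adj_mat ?M * \<beta>) $$ (a,b) = (\<Sum>l<n. (\<Sum>i<n. \<gamma> $$ (a,i) * adj_mat ?M $$ (i,l)) * \<beta> $$ (l,b))"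
      using ab dims adj by (simp add: index_mult_mat_sum del: index_mult_mat(1))
    also have "\<dots> = (\<Sum>l<n. (\<Sum>i<n. \<gamma> $$ (a,i) * poly (Q i l) z) * \<beta> $$ (l,b))"
      using Q by (intro sum.cong refl arg_cong2[of _ _ _ _ "(*)"]) auto
    finally have adj_entry: "(\<gamma> * adj_mat ?M * \<beta>) $$ (a,b) = \<dots>" .
    have "\<gamma> * minv ?M * \<beta> = inverse (poly d z) \<cdot>\<^sub>m (\<gamma> * adj_mat ?M * \<beta>)"
      using minv_eq_adj_mat[OF M] d nz dims adj by (simp add: mult_smult_dims smult_mult_dims)
    then have "tf \<delta> \<gamma> \<alpha> \<beta> z $$ (a,b) = \<delta> $$ (a,b) + z * (inverse (poly d z) * (\<gamma> * adj_mat ?M * \<beta>) $$ (a,b))"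
      using dims ab by (simp add: tf_def del: index_mult_mat(1))
    also have "\<dots> = poly (P a b) z / poly d z"
      unfolding adj_entry using nz by (simp add: P_def poly_sum field_simps)
    finally show "tf \<delta> \<gamma> \<alpha> \<beta> z $$ (a,b) = poly (P a b) z / poly d z" .
  qed
qed

text \<open>Induction on the degree of d. A zero w of d in the disc is also a zero of P by the
  inequality. After division of both by z - w the inequality persists away from w, and at w by
  continuity.\<close>

lemma poly_cancel_closed_disc:
  fixes P d :: "complex poly"
  assumes "d \<noteq> 0" "\<And>z. z \<in> cball 0 1 \<Longrightarrow> cmod (poly P z) \<le> cmod (poly d z)"
  shows "\<exists>g P' d'. P = g * P' \<and> d = g * d' \<and> (\<forall>z\<in>cball 0 1. poly d' z \<noteq> 0)"
  using assms
proof (induction "degree d" arbitrary: P d rule: less_induct)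
  case less
  show ?case
  proof (cases "\<forall>z\<in>cball 0 1. poly d z \<noteq> 0")
    case True
    then show ?thesis by (intro exI[of _ 1] exI[of _ P] exI[of _ d]) auto
  next
    case False
    then obtain w where w: "w \<in> cball 0 1" "poly d w = 0" by blast
    with less.prems(2)[of w] have "poly P w = 0" by simp
    with w obtain d1 P1 where d1: "d = [:-w,1:] * d1" and P1: "P = [:-w,1:] * P1"
      by (metis dvdE poly_eq_0_iff_dvd)
    have d10: "d1 \<noteq> 0" using d1 less.prems(1) by auto
    then have deg: "degree d1 < degree d" unfolding d1 by (subst degree_mult_eq) auto
    let ?T = "{z. cmod (poly P1 z) \<le> cmod (poly d1 z)}"
    have off: "z \<in> ?T" if "z \<in> cball 0 1 - {w}" for z
    proof -
      have "cmod (z - w) * cmod (poly P1 z) \<le> cmod (z - w) * cmod (poly d1 z)"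
        using less.prems(2)[of z] that by (simp add: d1 P1 algebra_simps flip: norm_mult)
      then show ?thesis using that by simp
    qed
    have "closed ?T" by (intro closed_Collect_le continuous_intros)
    \<comment> \<open>A connected set with more than one point has no isolated point, so w is
      approached from within the disc even if it lies on the circle.\<close>
    moreover have "w islimpt ?T"
    proof -
      have "(0::complex) \<in> cball 0 1" "(1::complex) \<in> cball 0 1" by auto
      then have "\<nexists>x. cball (0::complex) 1 = {x}" by (metis singletonD zero_neq_one)
      then have "w islimpt cball 0 1" using w(1) by (intro connected_imp_perfect) auto
      then have "w islimpt cball 0 1 - {w}" using islimpt_punctured by blast
      then show ?thesis by (rule islimpt_subset) (use off in blast)
    qed
    ultimately have "w \<in> ?T" by (simp add: closed_limpt)
    with off have "cmod (poly P1 z) \<le> cmod (poly d1 z)" if "z \<in> cball 0 1" for z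
      using that by (cases "z = w") auto
    from less.hyps[OF deg d10 this] obtain g P' d'
      where "P1 = g * P'" "d1 = g * d'" "\<forall>z\<in>cball 0 1. poly d' z \<noteq> 0" by blast
    then show ?thesis
      by (intro exI[of _ "[:-w,1:] * g"] exI[of _ P'] exI[of _ d']) (simp add: d1 P1 mult.assoc del: mult_pCons_left)
  qed
qed

section \<open>Contractive realizations\<close>

lemma contraction_det_nonzero:
  assumes \<alpha>: "\<alpha> \<in> carrier_mat n n" "\<And>x. x \<in> carrier_vec n \<Longrightarrow> vnorm (\<alpha> *\<^sub>v x) \<le> vnorm x"
    and z: "cmod z < 1"
  shows "det (1\<^sub>m n - z \<cdot>\<^sub>m \<alpha>) \<noteq> 0"
proof
  assume "det (1\<^sub>m n - z \<cdot>\<^sub>m \<alpha>) = 0"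
  then obtain v where v: "v \<in> carrier_vec n" "v \<noteq> 0\<^sub>v n" "(1\<^sub>m n - z \<cdot>\<^sub>m \<alpha>) *\<^sub>v v = 0\<^sub>v n"
    using det_0_iff_vec_prod_zero[OF minus_carrier_mat[OF smult_carrier_mat[OF \<alpha>(1)]]] by blast
  have "(1\<^sub>m n - z \<cdot>\<^sub>m \<alpha>) *\<^sub>v v = v - z \<cdot>\<^sub>v (\<alpha> *\<^sub>v v)"
    using \<alpha>(1) v(1) by (simp add: minus_mult_mat_vec_dims smult_mult_mat_vec_dims)
  then have zero: "v - z \<cdot>\<^sub>v (\<alpha> *\<^sub>v v) = 0\<^sub>v n" using v(3) by simp
  have "v = z \<cdot>\<^sub>v (\<alpha> *\<^sub>v v)"
  proof (rule eq_vecI)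
    fix i assume "i < dim_vec (z \<cdot>\<^sub>v (\<alpha> *\<^sub>v v))"
    then have i: "i < n" using \<alpha>(1) by simp
    then show "v $ i = (z \<cdot>\<^sub>v (\<alpha> *\<^sub>v v)) $ i"
      using arg_cong[OF zero, of "\<lambda>u. u $ i"] \<alpha>(1) v(1) by simp
  qed (use \<alpha>(1) v(1) in auto)
  then have "vnorm v = cmod z * vnorm (\<alpha> *\<^sub>v v)" by (metis vnorm_smult)
  also have "\<dots> \<le> cmod z * vnorm v" using \<alpha>(2)[OF v(1)] by (simp add: mult_left_mono)
  finally have "vnorm v \<le> 0" using z
    by (smt (verit) mult_le_cancel_right1 vnorm_nonneg)
  then have "vnorm v = 0" using vnorm_nonneg[of v] by linarith
  then show False using v by (simp add: vnorm_eq_0_iff)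
qed

text \<open>Energy balance: for x = (I - z \<alpha>)^(-1) \<beta> u the block matrix maps (z x, u)
  to (x, X(z) u), where X(z) is the value of the transfer function. Since |z| < 1, the energy of x
  on the output side absorbs that of z x on the input side.\<close>

lemma contractive_realization:
  assumes dims: "\<alpha> \<in> carrier_mat n n" "\<beta> \<in> carrier_mat n k" "\<gamma> \<in> carrier_mat p n" "\<delta> \<in> carrier_mat p k"
    and contr: "\<forall>x \<in> carrier_vec n. \<forall>u \<in> carrier_vec k.
      (vnorm (\<alpha> *\<^sub>v x + \<beta> *\<^sub>v u))\<^sup>2 + (vnorm (\<gamma> *\<^sub>v x + \<delta> *\<^sub>v u))\<^sup>2 \<le> (vnorm x)\<^sup>2 + (vnorm u)\<^sup>2"
    and z: "cmod z < 1"
  shows "det (1\<^sub>m n - z \<cdot>\<^sub>m \<alpha>) \<noteq> 0"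
    "u \<in> carrier_vec k \<Longrightarrow> vnorm (tf \<delta> \<gamma> \<alpha> \<beta> z *\<^sub>v u) \<le> vnorm u"
proof -
  have d: "dim_row \<alpha> = n" "dim_col \<alpha> = n" "dim_row \<beta> = n" "dim_col \<beta> = k" "dim_row \<gamma> = p" "dim_col \<gamma> = n"
    "dim_row \<delta> = p" "dim_col \<delta> = k" using dims by auto
  show det: "det (1\<^sub>m n - z \<cdot>\<^sub>m \<alpha>) \<noteq> 0"
  proof (rule contraction_det_nonzero[OF dims(1) _ z])
    fix x :: "complex vec" assume x: "x \<in> carrier_vec n"
    \<comment> \<open>With zero input the energy inequality makes \<alpha> itself a
      contraction.\<close>
    have "\<alpha> *\<^sub>v x + \<beta> *\<^sub>v 0\<^sub>v k = \<alpha> *\<^sub>v x" using d by (auto simp: scalar_prod_def)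
    then have "(vnorm (\<alpha> *\<^sub>v x))\<^sup>2 + (vnorm (\<gamma> *\<^sub>v x + \<delta> *\<^sub>v 0\<^sub>v k))\<^sup>2 \<le> (vnorm x)\<^sup>2"
      using contr[rule_format, OF x, of "0\<^sub>v k"] by simp
    then have "(vnorm (\<alpha> *\<^sub>v x))\<^sup>2 \<le> (vnorm x)\<^sup>2"
      using zero_le_power2[of "vnorm (\<gamma> *\<^sub>v x + \<delta> *\<^sub>v 0\<^sub>v k)"] by linarith
    then show "vnorm (\<alpha> *\<^sub>v x) \<le> vnorm x" using power2_le_imp_le vnorm_nonneg by blast
  qed
  assume u: "u \<in> carrier_vec k"
  let ?M = "1\<^sub>m n - z \<cdot>\<^sub>m \<alpha>"
  have M: "?M \<in> carrier_mat n n" using dims by auto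
  note inv = minv_properties[OF M det]
  have di: "dim_row (minv ?M) = n" "dim_col (minv ?M) = n" "dim_vec u = k" using inv u by auto
  define x where "x = minv ?M *\<^sub>v (\<beta> *\<^sub>v u)"
  have x: "x \<in> carrier_vec n" using di by (auto simp: x_def intro!: carrier_vecI)
  have "?M *\<^sub>v x = (?M * minv ?M) *\<^sub>v (\<beta> *\<^sub>v u)"
    unfolding x_def using d di by (intro mult_mat_vec_assoc_dims[symmetric]) auto
  also have "\<dots> = \<beta> *\<^sub>v u" unfolding inv(2) using d by (auto simp: carrier_dim_vec)
  finally have \<beta>u: "x - z \<cdot>\<^sub>v (\<alpha> *\<^sub>v x) = \<beta> *\<^sub>v u"
    using d x by (simp add: minus_mult_mat_vec_dims smult_mult_mat_vec_dims)
  have state: "\<alpha> *\<^sub>v (z \<cdot>\<^sub>v x) + \<beta> *\<^sub>v u = x"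
    unfolding \<beta>u[symmetric] using d x by (auto simp: mult_mat_smult_vec_dims intro!: eq_vecI)
  have "tf \<delta> \<gamma> \<alpha> \<beta> z *\<^sub>v u = \<delta> *\<^sub>v u + z \<cdot>\<^sub>v (\<gamma> *\<^sub>v x)"
    using d di by (simp add: tf_def x_def add_mult_mat_vec_dims smult_mult_mat_vec_dims mult_mat_vec_assoc_dims)
  also have "\<dots> = \<gamma> *\<^sub>v (z \<cdot>\<^sub>v x) + \<delta> *\<^sub>v u"
    using d x by (auto simp: mult_mat_smult_vec_dims intro!: eq_vecI)
  finally have out: "tf \<delta> \<gamma> \<alpha> \<beta> z *\<^sub>v u = \<dots>" .
  have "(vnorm x)\<^sup>2 + (vnorm (tf \<delta> \<gamma> \<alpha> \<beta> z *\<^sub>v u))\<^sup>2 \<le> (vnorm (z \<cdot>\<^sub>v x))\<^sup>2 + (vnorm u)\<^sup>2"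
    unfolding out using contr[rule_format, of "z \<cdot>\<^sub>v x" u] x u unfolding state by simp
  also have "(vnorm (z \<cdot>\<^sub>v x))\<^sup>2 \<le> (vnorm x)\<^sup>2"
    unfolding vnorm_smult using z by (intro power_mono mult_left_le_one_le) auto
  finally have "(vnorm (tf \<delta> \<gamma> \<alpha> \<beta> z *\<^sub>v u))\<^sup>2 \<le> (vnorm u)\<^sup>2" by simp
  then show "vnorm (tf \<delta> \<gamma> \<alpha> \<beta> z *\<^sub>v u) \<le> vnorm u" using power2_le_imp_le vnorm_nonneg by blast
qed

lemma op_norm_le_oneI:
  assumes "\<And>v. v \<in> carrier_vec (dim_col M) \<Longrightarrow> vnorm (M *\<^sub>v v) \<le> vnorm v"
  shows "op_norm M \<le> 1"
  unfolding op_norm_def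
proof (rule cSup_least)
  show "{vnorm (M *\<^sub>v v) |v. v \<in> carrier_vec (dim_col M) \<and> vnorm v \<le> 1} \<noteq> {}"
    by (auto intro!: exI[of _ "0\<^sub>v (dim_col M)"])
qed (use assms in force)

lemma tf_carrier:
  assumes "C \<in> carrier_mat m n" "B \<in> carrier_mat n k" "D \<in> carrier_mat m k"
  shows "tf D C A B z \<in> carrier_mat m k"
  using assms by (auto simp: tf_def intro!: carrier_matI)

text \<open>The state equation \<open>\<Upsilon> \<alpha> + B1 \<gamma> = A \<Upsilon>\<close> is equivalent to the resolvent identity
  \<open>z (I - z A)\<^sup>-\<^sup>1 B1 \<gamma> (I - z \<alpha>)\<^sup>-\<^sup>1 = (I - z A)\<^sup>-\<^sup>1 \<Upsilon> - \<Upsilon> (I - z \<alpha>)\<^sup>-\<^sup>1\<close>,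
  which turns the product of the two transfer functions into the transfer function of \<open>(A, B, C, D)\<close>.\<close>

lemma tf_mult_eq:
  assumes dims: "A \<in> carrier_mat n n" "C \<in> carrier_mat m n" "B1 \<in> carrier_mat n p" "D1 \<in> carrier_mat m p"
      "B \<in> carrier_mat n k" "D \<in> carrier_mat m k" "\<Upsilon> \<in> carrier_mat n n"
      "\<alpha> \<in> carrier_mat n n" "\<beta> \<in> carrier_mat n k" "\<gamma> \<in> carrier_mat p n" "\<delta> \<in> carrier_mat p k"
    and eqs: "\<Upsilon> * \<alpha> + B1 * \<gamma> = A * \<Upsilon>" "\<Upsilon> * \<beta> + B1 * \<delta> = B" "D1 * \<gamma> = C * \<Upsilon>" "D1 * \<delta> = D"
    and inv: "det (1\<^sub>m n - z \<cdot>\<^sub>m A) \<noteq> 0" "det (1\<^sub>m n - z \<cdot>\<^sub>m \<alpha>) \<noteq> 0"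
  shows "tf D1 C A B1 z * tf \<delta> \<gamma> \<alpha> \<beta> z = tf D C A B z"
proof -
  let ?M = "1\<^sub>m n - z \<cdot>\<^sub>m A" and ?N = "1\<^sub>m n - z \<cdot>\<^sub>m \<alpha>"
  define R where "R = minv ?M"
  define \<rho> where "\<rho> = minv ?N"
  have MN: "?M \<in> carrier_mat n n" "?N \<in> carrier_mat n n" using dims by auto
  have R: "R \<in> carrier_mat n n" "R * ?M = 1\<^sub>m n" using minv_properties[OF MN(1) inv(1)] by (auto simp: R_def)
  have \<rho>: "\<rho> \<in> carrier_mat n n" "?N * \<rho> = 1\<^sub>m n" using minv_properties[OF MN(2) inv(2)] by (auto simp: \<rho>_def)
  have d: "dim_row A = n" "dim_col A = n" "dim_row C = m" "dim_col C = n" "dim_row B1 = n" "dim_col B1 = p"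
    "dim_row D1 = m" "dim_col D1 = p" "dim_row \<Upsilon> = n" "dim_col \<Upsilon> = n" "dim_row \<alpha> = n" "dim_col \<alpha> = n"
    "dim_row \<beta> = n" "dim_col \<beta> = k" "dim_row \<gamma> = p" "dim_col \<gamma> = n" "dim_row \<delta> = p" "dim_col \<delta> = k"
    "dim_row R = n" "dim_col R = n" "dim_row \<rho> = n" "dim_col \<rho> = n"
    using dims R \<rho> by auto
  have "z \<cdot>\<^sub>m (B1 * \<gamma>) = \<Upsilon> * ?N - ?M * \<Upsilon>"
  proof -
    have "\<Upsilon> * ?N - ?M * \<Upsilon> = z \<cdot>\<^sub>m (A * \<Upsilon>) - z \<cdot>\<^sub>m (\<Upsilon> * \<alpha>)"
      using d by (simp add: mult_minus_distrib_dims minus_mult_distrib_dims mult_smult_dims smult_mult_dims)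
        (auto intro!: eq_matI)
    also have "\<dots> = z \<cdot>\<^sub>m (B1 * \<gamma>)"
      unfolding eqs(1)[symmetric] using d by (intro eq_matI) (auto simp: algebra_simps)
    finally show ?thesis by simp
  qed
  then have "R * (z \<cdot>\<^sub>m (B1 * \<gamma>)) * \<rho> = R * (\<Upsilon> * ?N - ?M * \<Upsilon>) * \<rho>" by simp
  also have "\<dots> = R * \<Upsilon> * (?N * \<rho>) - (R * ?M) * \<Upsilon> * \<rho>"
  proof -
    have "R * (\<Upsilon> * ?N - ?M * \<Upsilon>) = R * (\<Upsilon> * ?N) - R * (?M * \<Upsilon>)"
      using d by (intro mult_minus_distrib_dims) auto
    moreover have "(R * (\<Upsilon> * ?N) - R * (?M * \<Upsilon>)) * \<rho> = R * (\<Upsilon> * ?N) * \<rho> - R * (?M * \<Upsilon>) * \<rho>"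
      using d by (intro minus_mult_distrib_dims) auto
    moreover have "R * (\<Upsilon> * ?N) * \<rho> = R * \<Upsilon> * (?N * \<rho>)"
      using d by (simp add: mult_assoc_dims)
    moreover have "R * (?M * \<Upsilon>) * \<rho> = (R * ?M) * \<Upsilon> * \<rho>"
      using d by (simp add: mult_assoc_dims)
    ultimately show ?thesis by simp
  qed
  also have "\<dots> = R * \<Upsilon> - \<Upsilon> * \<rho>" unfolding R(2) \<rho>(2) using d by simp
  finally have key: "R * (z \<cdot>\<^sub>m (B1 * \<gamma>)) * \<rho> = R * \<Upsilon> - \<Upsilon> * \<rho>" .
  have B1\<delta>: "B1 * \<delta> = B - \<Upsilon> * \<beta>" unfolding eqs(2)[symmetric] using d by (intro eq_matI) auto
  \<comment> \<open>The cross terms of the product: the z-linear terms contribute T1 and T2 - T3,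
    and the quadratic term collapses to z times T3 - T1 by the resolvent identity, so that only T2
    survives.\<close>
  define T1 where "T1 = C * \<Upsilon> * \<rho> * \<beta>"
  define T2 where "T2 = C * R * B"
  define T3 where "T3 = C * R * \<Upsilon> * \<beta>"
  have dT: "dim_row T1 = m" "dim_col T1 = k" "dim_row T2 = m" "dim_col T2 = k" "dim_row T3 = m" "dim_col T3 = k"
    "dim_row D = m" "dim_col D = k"
    using d dims by (auto simp: T1_def T2_def T3_def)
  have t1: "D1 * (\<gamma> * \<rho> * \<beta>) = T1"
  proof -
    have "D1 * (\<gamma> * \<rho> * \<beta>) = (D1 * \<gamma>) * \<rho> * \<beta>" using d by (simp add: mult_assoc_dims)
    then show ?thesis unfolding eqs(3) T1_def .
  qed
  have t2: "(C * R * B1) * \<delta> = T2 - T3"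
  proof -
    have "(C * R * B1) * \<delta> = C * R * (B1 * \<delta>)" using d by (simp add: mult_assoc_dims)
    also have "\<dots> = C * R * B - C * R * (\<Upsilon> * \<beta>)"
      unfolding B1\<delta> using d dims by (intro mult_minus_distrib_dims) auto
    finally show ?thesis using d by (simp add: T2_def T3_def mult_assoc_dims)
  qed
  have t3: "z \<cdot>\<^sub>m ((C * R * B1) * (\<gamma> * \<rho> * \<beta>)) = T3 - T1"
  proof -
    have "z \<cdot>\<^sub>m ((C * R * B1) * (\<gamma> * \<rho> * \<beta>)) = C * (R * (z \<cdot>\<^sub>m (B1 * \<gamma>)) * \<rho>) * \<beta>"
      using d by (simp add: mult_assoc_dims mult_smult_dims smult_mult_dims)
    also have "\<dots> = C * (R * \<Upsilon>) * \<beta> - C * (\<Upsilon> * \<rho>) * \<beta>"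
      unfolding key using d by (simp add: mult_minus_distrib_dims minus_mult_distrib_dims)
    finally show ?thesis using d by (simp add: T1_def T3_def mult_assoc_dims)
  qed
  have "tf D1 C A B1 z * tf \<delta> \<gamma> \<alpha> \<beta> z = (D1 + z \<cdot>\<^sub>m (C * R * B1)) * (\<delta> + z \<cdot>\<^sub>m (\<gamma> * \<rho> * \<beta>))"
    using d by (simp add: tf_def R_def \<rho>_def)
  also have "\<dots> = (D1 * \<delta> + z \<cdot>\<^sub>m (D1 * (\<gamma> * \<rho> * \<beta>)))
      + (z \<cdot>\<^sub>m ((C * R * B1) * \<delta>) + z \<cdot>\<^sub>m (z \<cdot>\<^sub>m ((C * R * B1) * (\<gamma> * \<rho> * \<beta>))))"
    using d by (simp add: add_mult_distrib_dims mult_add_distrib_dims mult_smult_dims smult_mult_dims)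
      (auto intro!: eq_matI simp: algebra_simps simp del: index_mult_mat(1))
  also have "\<dots> = (D + z \<cdot>\<^sub>m T1) + (z \<cdot>\<^sub>m (T2 - T3) + z \<cdot>\<^sub>m (T3 - T1))"
    unfolding t1 t2 t3 eqs(4) ..
  also have "\<dots> = D + z \<cdot>\<^sub>m T2" using dT by (intro eq_matI) (auto simp: algebra_simps)
  also have "\<dots> = tf D C A B z" using d by (simp add: tf_def T2_def R_def)
  finally show ?thesis .
qed

text \<open>On the circle I - z \<alpha> may be singular, where \<open>minv\<close> carries no
  information. The extension is therefore given by reduced fractions, with a separate cancellation
  for each entry.\<close>

lemma stable_extension_contractive:
  assumes dims: "\<alpha> \<in> carrier_mat n n" "\<beta> \<in> carrier_mat n k" "\<gamma> \<in> carrier_mat p n" "\<delta> \<in> carrier_mat p k"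
    and contr: "\<forall>x \<in> carrier_vec n. \<forall>u \<in> carrier_vec k.
      (vnorm (\<alpha> *\<^sub>v x + \<beta> *\<^sub>v u))\<^sup>2 + (vnorm (\<gamma> *\<^sub>v x + \<delta> *\<^sub>v u))\<^sup>2 \<le> (vnorm x)\<^sup>2 + (vnorm u)\<^sup>2"
  shows "\<exists>X. stable_extension p k X \<alpha> (tf \<delta> \<gamma> \<alpha> \<beta>)"
proof -
  note real = contractive_realization[OF dims contr]
  from tf_rational[OF dims] obtain d P where d: "\<And>z. det (1\<^sub>m n - z \<cdot>\<^sub>m \<alpha>) = poly d z"
    and P: "\<And>z a b. a < p \<Longrightarrow> b < k \<Longrightarrow> poly d z \<noteq> 0 \<Longrightarrow> tf \<delta> \<gamma> \<alpha> \<beta> z $$ (a,b) = poly (P a b) z / poly d z"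
    by blast
  have d0: "d \<noteq> 0" using real(1)[of 0] d[of 0] by auto
  have "\<exists>P' d' g. P a b = g * P' \<and> d = g * d' \<and> (\<forall>z\<in>cball 0 1. poly d' z \<noteq> 0)"
    if ab: "a < p" "b < k" for a b
  proof -
    \<comment> \<open>Written without division, the bound is a closed condition that makes sense at
      zeros of d, so it passes to the closed disc.\<close>
    let ?T = "{z. cmod (poly (P a b) z) \<le> cmod (poly d z)}"
    have "ball 0 1 \<subseteq> ?T"
    proof
      fix z :: complex assume "z \<in> ball 0 1"
      then have z: "cmod z < 1" by simp
      have nz: "poly d z \<noteq> 0" using real(1)[OF z] d by simp
      have tfc: "tf \<delta> \<gamma> \<alpha> \<beta> z \<in> carrier_mat p k" by (rule tf_carrier[OF dims(3,2,4)])
      have "cmod (tf \<delta> \<gamma> \<alpha> \<beta> z $$ (a,b)) = cmod ((tf \<delta> \<gamma> \<alpha> \<beta> z *\<^sub>v unit_vec k b) $ a)"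
        using ab tfc by simp
      also have "\<dots> \<le> vnorm (tf \<delta> \<gamma> \<alpha> \<beta> z *\<^sub>v unit_vec k b)"
        using ab tfc by (intro cmod_index_le_vnorm) simp
      also have "\<dots> \<le> vnorm (unit_vec k b)" by (rule real(2)[OF z]) simp
      finally have "cmod (poly (P a b) z / poly d z) \<le> 1"
        using P[OF ab nz] ab by (simp add: vnorm_unit_vec)
      then show "z \<in> ?T" using nz by (simp add: norm_divide field_simps)
    qed
    moreover have "closed ?T" by (intro closed_Collect_le continuous_intros)
    ultimately have "closure (ball 0 1) \<subseteq> ?T" by (rule closure_minimal)
    then have "cball 0 1 \<subseteq> ?T" by simp
    then show ?thesis using poly_cancel_closed_disc[OF d0, of "P a b"] by blast
  qed
  then obtain P' d' g where g: "\<And>a b. a < p \<Longrightarrow> b < k \<Longrightarrow> P a b = g a b * P' a b"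
    "\<And>a b. a < p \<Longrightarrow> b < k \<Longrightarrow> d = g a b * d' a b"
    "\<And>a b z. a < p \<Longrightarrow> b < k \<Longrightarrow> z \<in> cball 0 1 \<Longrightarrow> poly (d' a b) z \<noteq> 0"
    by metis
  define X where "X z = mat p k (\<lambda>(a,b). poly (P' a b) z / poly (d' a b) z)" for z
  define S where "S = (\<Inter>a\<in>{..<p}. \<Inter>b\<in>{..<k}. {z. poly (d' a b) z \<noteq> 0})"
  have "stable_extension p k X \<alpha> (tf \<delta> \<gamma> \<alpha> \<beta>)"
    unfolding stable_extension_def
  proof (intro conjI allI impI exI[of _ S])
    show "X z \<in> carrier_mat p k" for z by (simp add: X_def)
    show "open S" unfolding S_def by (intro open_INT ballI open_Collect_neq continuous_intros) auto
    show "cball 0 1 \<subseteq> S" using g(3) by (auto simp: S_def)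
    show "(\<lambda>z. X z $$ (a,b)) holomorphic_on S" if "a < p" "b < k" for a b
      using that by (auto simp: X_def S_def intro!: holomorphic_intros)
    fix z assume "det (1\<^sub>m (dim_row \<alpha>) - z \<cdot>\<^sub>m \<alpha>) \<noteq> 0"
    then have nz: "poly d z \<noteq> 0" using d dims by simp
    show "X z = tf \<delta> \<gamma> \<alpha> \<beta> z"
    proof (rule eq_matI)
      fix a b assume "a < dim_row (tf \<delta> \<gamma> \<alpha> \<beta> z)" "b < dim_col (tf \<delta> \<gamma> \<alpha> \<beta> z)"
      then have ab: "a < p" "b < k" using tf_carrier[OF dims(3,2,4), of \<alpha> z] by auto
      have "poly d z = poly (g a b) z * poly (d' a b) z" "poly (P a b) z = poly (g a b) z * poly (P' a b) z"
        using g(1,2)[OF ab] by (metis poly_mult)+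
      then show "X z $$ (a,b) = tf \<delta> \<gamma> \<alpha> \<beta> z $$ (a,b)"
        using P[OF ab nz] nz ab by (simp add: X_def)
    qed (use tf_carrier[OF dims(3,2,4), of \<alpha> z] in \<open>auto simp: X_def\<close>)
  qed
  then show ?thesis by blast
qed

text \<open>Common to both claims: B, D, \<beta>, \<delta> stand for the data of K in one and of F
  in the other, while \<alpha>, \<gamma> and \<Upsilon> are shared.\<close>

lemma contractive_solution:
  assumes dims: "A \<in> carrier_mat n n" "C \<in> carrier_mat m n" "B1 \<in> carrier_mat n p" "D1 \<in> carrier_mat m p"
      "B \<in> carrier_mat n k" "D \<in> carrier_mat m k" "\<Upsilon> \<in> carrier_mat n n"
      "\<alpha> \<in> carrier_mat n n" "\<beta> \<in> carrier_mat n k" "\<gamma> \<in> carrier_mat p n" "\<delta> \<in> carrier_mat p k"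
    and A: "power_decay A"
    and eqs: "\<Upsilon> * \<alpha> + B1 * \<gamma> = A * \<Upsilon>" "\<Upsilon> * \<beta> + B1 * \<delta> = B" "D1 * \<gamma> = C * \<Upsilon>" "D1 * \<delta> = D"
    and contr: "\<forall>x \<in> carrier_vec n. \<forall>u \<in> carrier_vec k.
      (vnorm (\<alpha> *\<^sub>v x + \<beta> *\<^sub>v u))\<^sup>2 + (vnorm (\<gamma> *\<^sub>v x + \<delta> *\<^sub>v u))\<^sup>2 \<le> (vnorm x)\<^sup>2 + (vnorm u)\<^sup>2"
  shows "\<exists>X. stable_extension p k X \<alpha> (tf \<delta> \<gamma> \<alpha> \<beta>)
      \<and> (\<forall>z \<in> ball 0 1. tf D1 C A B1 z * X z = tf D C A B z)
      \<and> (\<forall>z \<in> ball 0 1. op_norm (X z) \<le> 1)"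
proof -
  note real = contractive_realization[OF dims(8-11) contr]
  from stable_extension_contractive[OF dims(8-11) contr] obtain X
    where X: "stable_extension p k X \<alpha> (tf \<delta> \<gamma> \<alpha> \<beta>)" by blast
  have Xz: "X z = tf \<delta> \<gamma> \<alpha> \<beta> z" if "cmod z < 1" for z
    using X real(1)[OF that] dims(8) by (simp add: stable_extension_def)
  have detA: "det (1\<^sub>m n - z \<cdot>\<^sub>m A) \<noteq> 0" if "cmod z < 1" for z
  proof
    have M: "1\<^sub>m n - z \<cdot>\<^sub>m A \<in> carrier_mat n n" using dims(1) by auto
    assume "det (1\<^sub>m n - z \<cdot>\<^sub>m A) = 0"
    then have "det ((1\<^sub>m n - z \<cdot>\<^sub>m A) * msuminf n n (\<lambda>k. z ^ k \<cdot>\<^sub>m A ^\<^sub>m k)) = 0"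
      by (subst det_mult[OF M]) auto
    then show False unfolding neumann_series(2)[OF dims(1) A that] by simp
  qed
  show ?thesis
  proof (intro exI[of _ X] conjI ballI X)
    fix z :: complex assume "z \<in> ball 0 1"
    then have z: "cmod z < 1" by simp
    show "tf D1 C A B1 z * X z = tf D C A B z"
      unfolding Xz[OF z] by (rule tf_mult_eq[OF dims eqs detA[OF z] real(1)[OF z]])
    show "op_norm (X z) \<le> 1"
      unfolding Xz[OF z] using real(2)[OF z] tf_carrier[OF dims(10,9,11), of \<alpha> z]
      by (intro op_norm_le_oneI) auto
  qed
qed

subsection \<open>Block matrices\<close>

lemma dim_hcat [simp]: "dim_row (hcat X Y) = dim_row X" "dim_col (hcat X Y) = dim_col X + dim_col Y"
  by (simp_all add: hcat_def)

lemma index_hcat: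
  "i < dim_row X \<Longrightarrow> j < dim_col X + dim_col Y \<Longrightarrow>
    hcat X Y $$ (i,j) = (if j < dim_col X then X $$ (i,j) else Y $$ (i, j - dim_col X))"
  by (simp add: hcat_def)

lemma hcat_carrier: "X \<in> carrier_mat a b \<Longrightarrow> Y \<in> carrier_mat a c \<Longrightarrow> hcat X Y \<in> carrier_mat a (b + c)"
  by (auto intro!: carrier_matI)

lemma mult_hcat:
  assumes "dim_col A = dim_row X" "dim_row X = dim_row Y"
  shows "A * hcat X Y = hcat (A * X) (A * Y)"
  using assms by (intro eq_matI) (auto simp: index_hcat scalar_prod_def intro!: sum.cong)

lemma add_hcat:
  assumes "dim_row X = dim_row Y" "dim_row X' = dim_row X" "dim_row Y' = dim_row X"
    "dim_col X' = dim_col X" "dim_col Y' = dim_col Y"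
  shows "hcat X Y + hcat X' Y' = hcat (X + X') (Y + Y')"
  using assms by (intro eq_matI) (auto simp: index_hcat)

lemma hcat_inject:
  assumes eq: "hcat X Y = hcat X' Y'" and "X \<in> carrier_mat a b" "X' \<in> carrier_mat a b"
    "Y \<in> carrier_mat a c" "Y' \<in> carrier_mat a c"
  shows "X = X'" "Y = Y'"
proof -
  have e: "hcat X Y $$ ij = hcat X' Y' $$ ij" for ij by (simp only: eq)
  show "X = X'"
  proof (rule eq_matI)
    fix i j assume "i < dim_row X'" "j < dim_col X'"
    then show "X $$ (i,j) = X' $$ (i,j)" using e[of "(i,j)"] assms(2-5) by (simp add: index_hcat)
  qed (use assms in auto)
  show "Y = Y'"
  proof (rule eq_matI)
    fix i j assume "i < dim_row Y'" "j < dim_col Y'"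
    then show "Y $$ (i,j) = Y' $$ (i,j)" using e[of "(i,j + b)"] assms(2-5) by (simp add: index_hcat)
  qed (use assms in auto)
qed

lemma hcat_mult_vec:
  assumes "dim_row X = dim_row Y" "dim_vec u = dim_col X" "dim_vec w = dim_col Y"
  shows "hcat X Y *\<^sub>v (u @\<^sub>v w) = X *\<^sub>v u + Y *\<^sub>v w"
proof (rule eq_vecI)
  fix i assume "i < dim_vec (X *\<^sub>v u + Y *\<^sub>v w)"
  then have i: "i < dim_row X" using assms by simp
  have "row (hcat X Y) i = row X i @\<^sub>v row Y i"
    using i assms by (intro eq_vecI) (auto simp: index_hcat)
  then show "(hcat X Y *\<^sub>v (u @\<^sub>v w)) $ i = (X *\<^sub>v u + Y *\<^sub>v w) $ i"
    using i assms scalar_prod_append[OF row_carrier row_carrier carrier_vecI[OF assms(2)] carrier_vecI[OF assms(3)]]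
    by simp
qed (use assms in auto)

lemma hcat_mult_hadj_hcat:
  assumes "X \<in> carrier_mat a b" "X' \<in> carrier_mat a' b" "Y \<in> carrier_mat a c" "Y' \<in> carrier_mat a' c"
  shows "hcat X Y * hadj (hcat X' Y') = X * hadj X' + Y * hadj Y'"
proof (rule eq_matI)
  fix i j assume "i < dim_row (X * hadj X' + Y * hadj Y')" "j < dim_col (X * hadj X' + Y * hadj Y')"
  then have ij: "i < a" "j < a'" using assms by auto
  have r: "row (hcat X Y) i = row X i @\<^sub>v row Y i"
    using ij assms by (intro eq_vecI) (auto simp: index_hcat)
  have c: "col (hadj (hcat X' Y')) j = col (hadj X') j @\<^sub>v col (hadj Y') j"
    using ij assms by (intro eq_vecI) (auto simp: index_hcat)
  show "(hcat X Y * hadj (hcat X' Y')) $$ (i,j) = (X * hadj X' + Y * hadj Y') $$ (i,j)"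
    using ij assms scalar_prod_append[of "row X i" b "row Y i" c "col (hadj X') j" "col (hadj Y') j"]
    by (simp add: r c carrier_vecI)
qed (use assms in auto)

lemma four_block_mat_inject:
  assumes eq: "four_block_mat A B C D = four_block_mat A' B' C' D'"
    and "A \<in> carrier_mat a c" "B \<in> carrier_mat a d" "C \<in> carrier_mat b c" "D \<in> carrier_mat b d"
      "A' \<in> carrier_mat a c" "B' \<in> carrier_mat a d" "C' \<in> carrier_mat b c" "D' \<in> carrier_mat b d"
  shows "A = A'" "B = B'" "C = C'" "D = D'"
proof -
  have e: "four_block_mat A B C D $$ ij = four_block_mat A' B' C' D' $$ ij" for ij by (simp only: eq)
  show "A = A'"
  proof (rule eq_matI)
    fix i j assume "i < dim_row A'" "j < dim_col A'"
    then show "A $$ (i,j) = A' $$ (i,j)" using e[of "(i,j)"] assms(2-) by simp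
  qed (use assms in auto)
  show "B = B'"
  proof (rule eq_matI)
    fix i j assume "i < dim_row B'" "j < dim_col B'"
    then show "B $$ (i,j) = B' $$ (i,j)" using e[of "(i,j + c)"] assms(2-) by simp
  qed (use assms in auto)
  show "C = C'"
  proof (rule eq_matI)
    fix i j assume "i < dim_row C'" "j < dim_col C'"
    then show "C $$ (i,j) = C' $$ (i,j)" using e[of "(i + a,j)"] assms(2-) by simp
  qed (use assms in auto)
  show "D = D'"
  proof (rule eq_matI)
    fix i j assume "i < dim_row D'" "j < dim_col D'"
    then show "D $$ (i,j) = D' $$ (i,j)" using e[of "(i + a,j + c)"] assms(2-) by simp
  qed (use assms in auto)
qed

lemma blk_carrier [simp]: "blk U i j a b \<in> carrier_mat a b"
  by (simp add: blk_def)

lemma four_block_mat_blk: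
  assumes "U \<in> carrier_mat (n + p) (n + (q + r))"
  shows "U = four_block_mat (blk U 0 0 n n) (hcat (blk U 0 n n q) (blk U 0 (n + q) n r))
    (blk U n 0 p n) (hcat (blk U n n p q) (blk U n (n + q) p r))"
  using assms by (intro eq_matI) (auto simp: blk_def index_hcat)

text \<open>The inputs u and w are kept apart so that setting one of them to zero yields the energy
  inequality for the other.\<close>

lemma partial_isometry_block_contraction:
  assumes dims: "\<alpha> \<in> carrier_mat n n" "\<beta>1 \<in> carrier_mat n q" "\<beta>2 \<in> carrier_mat n r"
      "\<gamma> \<in> carrier_mat p n" "\<delta>1 \<in> carrier_mat p q" "\<delta>2 \<in> carrier_mat p r"
    and U: "partial_isometry (four_block_mat \<alpha> (hcat \<beta>1 \<beta>2) \<gamma> (hcat \<delta>1 \<delta>2))"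
    and vecs: "x \<in> carrier_vec n" "u \<in> carrier_vec q" "w \<in> carrier_vec r"
  shows "(vnorm (\<alpha> *\<^sub>v x + (\<beta>1 *\<^sub>v u + \<beta>2 *\<^sub>v w)))\<^sup>2 + (vnorm (\<gamma> *\<^sub>v x + (\<delta>1 *\<^sub>v u + \<delta>2 *\<^sub>v w)))\<^sup>2
    \<le> (vnorm x)\<^sup>2 + ((vnorm u)\<^sup>2 + (vnorm w)\<^sup>2)"
proof -
  let ?U = "four_block_mat \<alpha> (hcat \<beta>1 \<beta>2) \<gamma> (hcat \<delta>1 \<delta>2)"
  have Uv: "?U *\<^sub>v (x @\<^sub>v (u @\<^sub>v w)) = (\<alpha> *\<^sub>v x + (\<beta>1 *\<^sub>v u + \<beta>2 *\<^sub>v w)) @\<^sub>v (\<gamma> *\<^sub>v x + (\<delta>1 *\<^sub>v u + \<delta>2 *\<^sub>v w))"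
    using dims vecs
    by (subst four_block_mat_mult_vec[of _ n n _ "q + r" _ p]) (auto simp: hcat_mult_vec intro!: hcat_carrier)
  have "vnorm (?U *\<^sub>v (x @\<^sub>v (u @\<^sub>v w))) \<le> vnorm (x @\<^sub>v (u @\<^sub>v w))"
    by (rule partial_isometry_contraction[OF U]) (use dims vecs in \<open>auto intro!: carrier_vecI\<close>)
  then have "(vnorm (?U *\<^sub>v (x @\<^sub>v (u @\<^sub>v w))))\<^sup>2 \<le> (vnorm (x @\<^sub>v (u @\<^sub>v w)))\<^sup>2"
    by (intro power_mono) auto
  then show ?thesis unfolding Uv vnorm_append .
qed

subsection \<open>The Toeplitz identity\<close>

lemma minus_minus_eq_imp_add_eq:
  fixes X Y Z V :: "complex mat"
  assumes "X - Y - Z = V" "X \<in> carrier_mat a b" "Y \<in> carrier_mat a b" "Z \<in> carrier_mat a b"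
  shows "V + (Y + Z) = X"
  unfolding assms(1)[symmetric] using assms(2-) by (intro eq_matI) auto

text \<open>Row 0 of the first block column is the lower right block of
  \<open>N * hadj N = M * hadj M\<close>. The rows below all carry a left factor C A^j, and removing
  it gives the upper right block.\<close>

lemma toeplitz_identity_consequences:
  assumes dims: "A \<in> carrier_mat n n" "C \<in> carrier_mat m n"
      "B1 \<in> carrier_mat n p" "B2 \<in> carrier_mat n q" "B3 \<in> carrier_mat n r"
      "D1 \<in> carrier_mat m p" "D2 \<in> carrier_mat m q" "D3 \<in> carrier_mat m r"
    and A: "power_decay A" and obs: "observable C A" and Q: "Q \<in> carrier_mat n n"
    and toeplitz: "\<And>i.
        toeplitz_prod_block (taylor_coeff m p (tf D1 C A B1)) (taylor_coeff m p (tf D1 C A B1)) i 0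
      - toeplitz_prod_block (taylor_coeff m q (tf D2 C A B2)) (taylor_coeff m q (tf D2 C A B2)) i 0
      - toeplitz_prod_block (taylor_coeff m r (tf D3 C A B3)) (taylor_coeff m r (tf D3 C A B3)) i 0
      = C * A ^\<^sub>m i * Q * hadj C"
  shows "C * Q * hadj C + (D2 * hadj D2 + D3 * hadj D3) = D1 * hadj D1"
    "A * Q * hadj C + (B2 * hadj D2 + B3 * hadj D3) = B1 * hadj D1"
proof -
  have blk: "toeplitz_prod_block (taylor_coeff m k (tf D C A B)) (taylor_coeff m k (tf D C A B)) i 0
      = (case i of 0 \<Rightarrow> D | Suc j \<Rightarrow> C * A ^\<^sub>m j * B) * hadj D"
    if "B \<in> carrier_mat n k" "D \<in> carrier_mat m k" for B D k i
    using dims that unfolding toeplitz_prod_block_0 taylor_coeff_tf[OF dims(1,2) that A]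
    by (auto split: nat.splits intro!: right_add_zero_mat carrier_matI)
  note T = toeplitz[unfolded blk[OF dims(3,6)] blk[OF dims(4,7)] blk[OF dims(5,8)]]
  have d: "dim_row A = n" "dim_col A = n" "dim_row C = m" "dim_col C = n" "dim_row B1 = n" "dim_col B1 = p"
    "dim_row B2 = n" "dim_col B2 = q" "dim_row B3 = n" "dim_col B3 = r" "dim_row D1 = m" "dim_col D1 = p"
    "dim_row D2 = m" "dim_col D2 = q" "dim_row D3 = m" "dim_col D3 = r" "dim_row Q = n" "dim_col Q = n"
    using dims Q by auto
  have "D1 * hadj D1 - D2 * hadj D2 - D3 * hadj D3 = C * Q * hadj C"
    using T[of 0] d by simp
  then show "C * Q * hadj C + (D2 * hadj D2 + D3 * hadj D3) = D1 * hadj D1"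
    by (rule minus_minus_eq_imp_add_eq[of _ _ _ _ m m]) (use d in \<open>auto intro!: carrier_matI\<close>)
  \<comment> \<open>The left side of the identity in row j + 1 is C A^j X, with X the same for every
    j.\<close>
  define X where "X = B1 * hadj D1 - B2 * hadj D2 - B3 * hadj D3"
  have "X - A * Q * hadj C = 0\<^sub>m n m"
  proof (rule observable_cancel[OF dims(1,2) _ obs])
    show "X - A * Q * hadj C \<in> carrier_mat n m" using d by (auto simp: X_def intro!: carrier_matI)
    fix j
    have "C * A ^\<^sub>m j * X = C * A ^\<^sub>m Suc j * Q * hadj C"
      using T[of "Suc j"] d by (simp add: X_def mult_minus_distrib_dims mult_assoc_dims)
    also have "\<dots> = C * A ^\<^sub>m j * (A * Q * hadj C)" using d by (simp add: mult_assoc_dims)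
    finally have eq: "C * A ^\<^sub>m j * X = C * A ^\<^sub>m j * (A * Q * hadj C)" .
    have "C * A ^\<^sub>m j * (X - A * Q * hadj C) = C * A ^\<^sub>m j * X - C * A ^\<^sub>m j * (A * Q * hadj C)"
      using d by (intro mult_minus_distrib_dims) (auto simp: X_def)
    then show "C * A ^\<^sub>m j * (X - A * Q * hadj C) = 0\<^sub>m m m" unfolding eq using d by simp
  qed
  then have "X = A * Q * hadj C"
    by (rule eq_mat_of_minus_eq_zero) (use d in \<open>auto simp: X_def intro!: carrier_matI\<close>)
  then show "A * Q * hadj C + (B2 * hadj D2 + B3 * hadj D3) = B1 * hadj D1"
    unfolding X_def
    by (rule minus_minus_eq_imp_add_eq[of _ _ _ _ n m]) (use d in \<open>auto intro!: carrier_matI\<close>)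
qed

text \<open>The three Stein equations added with their signs; this is the upper left block of
  \<open>N * hadj N = M * hadj M\<close>.\<close>

lemma gramian_difference_stein:
  assumes A: "A \<in> carrier_mat n n" "power_decay A"
    and B: "B1 \<in> carrier_mat n p" "B2 \<in> carrier_mat n q" "B3 \<in> carrier_mat n r"
  defines "Q \<equiv> ctrl_gram A B3 + ctrl_gram A B2 - ctrl_gram A B1"
  shows "A * Q * hadj A + (B2 * hadj B2 + B3 * hadj B3) = Q + B1 * hadj B1"
proof -
  define P1 P2 P3 where "P1 = ctrl_gram A B1" and "P2 = ctrl_gram A B2" and "P3 = ctrl_gram A B3"
  have c: "P1 \<in> carrier_mat n n" "P2 \<in> carrier_mat n n" "P3 \<in> carrier_mat n n"
    using ctrl_gram_carrier[OF A(1)] by (auto simp: P1_def P2_def P3_def)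
  have s: "P1 = B1 * hadj B1 + A * P1 * hadj A" "P2 = B2 * hadj B2 + A * P2 * hadj A"
    "P3 = B3 * hadj B3 + A * P3 * hadj A"
    unfolding P1_def P2_def P3_def by (rule ctrl_gram_stein[OF A] B)+
  have AQA: "A * Q * hadj A = A * P3 * hadj A + A * P2 * hadj A - A * P1 * hadj A"
    using A c by (simp add: Q_def P1_def[symmetric] P2_def[symmetric] P3_def[symmetric]
      mult_add_distrib_dims mult_minus_distrib_dims add_mult_distrib_dims minus_mult_distrib_dims)
  show ?thesis
  proof (rule eq_matI)
    fix i j assume "i < dim_row (Q + B1 * hadj B1)" "j < dim_col (Q + B1 * hadj B1)"
    then have ij: "i < n" "j < n" using B by auto
    have e: "P1 $$ (i,j) = (B1 * hadj B1) $$ (i,j) + (A * P1 * hadj A) $$ (i,j)"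
      "P2 $$ (i,j) = (B2 * hadj B2) $$ (i,j) + (A * P2 * hadj A) $$ (i,j)"
      "P3 $$ (i,j) = (B3 * hadj B3) $$ (i,j) + (A * P3 * hadj A) $$ (i,j)"
      using arg_cong[OF s(1), of "\<lambda>M. M $$ (i,j)"] arg_cong[OF s(2), of "\<lambda>M. M $$ (i,j)"]
        arg_cong[OF s(3), of "\<lambda>M. M $$ (i,j)"] ij A B
      by (simp_all del: index_mult_mat(1))
    have "(A * Q * hadj A + (B2 * hadj B2 + B3 * hadj B3)) $$ (i,j)
      = (A * P3 * hadj A) $$ (i,j) + (A * P2 * hadj A) $$ (i,j) - (A * P1 * hadj A) $$ (i,j)
        + ((B2 * hadj B2) $$ (i,j) + (B3 * hadj B3) $$ (i,j))"
      unfolding AQA using ij A B by (simp del: index_mult_mat(1))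
    also have "\<dots> = P3 $$ (i,j) + P2 $$ (i,j) - P1 $$ (i,j) + (B1 * hadj B1) $$ (i,j)"
      unfolding e by (simp del: index_mult_mat(1))
    also have "\<dots> = (Q + B1 * hadj B1) $$ (i,j)"
      unfolding Q_def P1_def[symmetric] P2_def[symmetric] P3_def[symmetric]
      using ij c B by (simp del: index_mult_mat(1))
    finally show "(A * Q * hadj A + (B2 * hadj B2 + B3 * hadj B3)) $$ (i,j) = (Q + B1 * hadj B1) $$ (i,j)" .
  qed (use A B c in \<open>auto simp: Q_def P1_def P2_def P3_def\<close>)
qed

section \<open>Assembly of the block matrices and extraction of the two solutions\<close>

theorem theorem1p2:
  fixes n m p q r :: nat
    and A C B1 B2 B3 D1 D2 D3 :: "complex mat"
  assumes dims: "A \<in> carrier_mat n n" "C \<in> carrier_mat m n"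
      "B1 \<in> carrier_mat n p" "B2 \<in> carrier_mat n q" "B3 \<in> carrier_mat n r"
      "D1 \<in> carrier_mat m p" "D2 \<in> carrier_mat m q" "D3 \<in> carrier_mat m r"
    and stable: "stable_mat A"
    and minimal: "minimal_realization C A (hcat B1 B2)"
    and toeplitz: "\<forall>i j.
        toeplitz_prod_block (taylor_coeff m p (tf D1 C A B1)) (taylor_coeff m p (tf D1 C A B1)) i j
      - toeplitz_prod_block (taylor_coeff m q (tf D2 C A B2)) (taylor_coeff m q (tf D2 C A B2)) i j
      - toeplitz_prod_block (taylor_coeff m r (tf D3 C A B3)) (taylor_coeff m r (tf D3 C A B3)) i j
      = C * A ^\<^sub>m i * (ctrl_gram A B3 + ctrl_gram A B2 - ctrl_gram A B1) * hadj A ^\<^sub>m j * hadj C"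
    and pos: "psd (ctrl_gram A B3 + ctrl_gram A B2 - ctrl_gram A B1)"
  shows
    "let Y = obs_gram C A;
         \<Upsilon> = psd_sqrt (ctrl_gram A B3 + ctrl_gram A B2 - ctrl_gram A B1);
         L = four_block_mat (\<Upsilon> * Y * \<Upsilon>) (\<Upsilon> * Y * B1)
                            (hadj B1 * Y * \<Upsilon>) (hadj D1 * D1 + hadj B1 * Y * B1);
         R = four_block_mat (\<Upsilon> * Y * A * \<Upsilon>) (hcat (\<Upsilon> * Y * B2) (\<Upsilon> * Y * B3))
                            (hadj D1 * C * \<Upsilon> + hadj B1 * Y * A * \<Upsilon>)
                            (hcat (hadj D1 * D2 + hadj B1 * Y * B2) (hadj D1 * D3 + hadj B1 * Y * B3));
         U = mp_inv L * R;
         \<alpha> = blk U 0 0 n n; \<beta>1 = blk U 0 n n q; \<beta>2 = blk U 0 (n + q) n r;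
         \<gamma> = blk U n 0 p n; \<delta>1 = blk U n n p q; \<delta>2 = blk U n (n + q) p r
     in partial_isometry U
      \<and> (\<exists>X. stable_extension p q X \<alpha> (tf \<delta>1 \<gamma> \<alpha> \<beta>1)
            \<and> (\<forall>z \<in> ball 0 1. tf D1 C A B1 z * X z = tf D2 C A B2 z)
            \<and> (\<forall>z \<in> ball 0 1. op_norm (X z) \<le> 1))
      \<and> (\<exists>\<Psi>. stable_extension p r \<Psi> \<alpha> (tf \<delta>2 \<gamma> \<alpha> \<beta>2)
            \<and> (\<forall>z \<in> ball 0 1. op_norm (\<Psi> z) \<le> 1)
            \<and> (\<forall>z \<in> ball 0 1. tf D1 C A B1 z * \<Psi> z = tf D3 C A B3 z))"
proof -
  define Q where "Q = ctrl_gram A B3 + ctrl_gram A B2 - ctrl_gram A B1"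
  define Y where "Y = obs_gram C A"
  define \<Upsilon> where "\<Upsilon> = psd_sqrt Q"
  have decay: "power_decay A" by (rule stable_mat_power_decay[OF dims(1) stable])
  have obs: "observable C A" using minimal by (simp add: minimal_realization_def)
  have Q: "Q \<in> carrier_mat n n" "psd Q"
    using pos ctrl_gram_carrier[OF dims(1)] by (auto simp: Q_def intro!: minus_carrier_mat)
  note \<Upsilon> = psd_sqrt_properties[OF Q(2,1), folded \<Upsilon>_def]
  have Y: "Y \<in> carrier_mat n n" "hadj Y = Y"
    using ctrl_gram_carrier[of "hadj A" n "hadj C"] dims
      ctrl_gram_psd[OF _ power_decay_hadj[OF dims(1) decay], of n "hadj C" m]
    by (auto simp: Y_def obs_gram_eq_ctrl_gram[OF dims(1)] psd_iff)
  have d: "dim_row A = n" "dim_col A = n" "dim_row C = m" "dim_col C = n" "dim_row B1 = n" "dim_col B1 = p"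
    "dim_row B2 = n" "dim_col B2 = q" "dim_row B3 = n" "dim_col B3 = r" "dim_row D1 = m" "dim_col D1 = p"
    "dim_row D2 = m" "dim_col D2 = q" "dim_row D3 = m" "dim_col D3 = r" "dim_row Q = n" "dim_col Q = n"
    "dim_row \<Upsilon> = n" "dim_col \<Upsilon> = n" "dim_row Y = n" "dim_col Y = n"
    using dims Q \<Upsilon> Y by auto
  have T: "C * Q * hadj C + (D2 * hadj D2 + D3 * hadj D3) = D1 * hadj D1"
    "A * Q * hadj C + (B2 * hadj D2 + B3 * hadj D3) = B1 * hadj D1"
  proof -
    have "toeplitz_prod_block (taylor_coeff m p (tf D1 C A B1)) (taylor_coeff m p (tf D1 C A B1)) i 0
      - toeplitz_prod_block (taylor_coeff m q (tf D2 C A B2)) (taylor_coeff m q (tf D2 C A B2)) i 0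
      - toeplitz_prod_block (taylor_coeff m r (tf D3 C A B3)) (taylor_coeff m r (tf D3 C A B3)) i 0
      = C * A ^\<^sub>m i * Q * hadj C" for i
      using toeplitz[rule_format, of i 0] d unfolding Q_def[symmetric] by simp
    from toeplitz_identity_consequences[OF dims decay obs Q(1) this]
    show "C * Q * hadj C + (D2 * hadj D2 + D3 * hadj D3) = D1 * hadj D1"
      "A * Q * hadj C + (B2 * hadj D2 + B3 * hadj D3) = B1 * hadj D1" by auto
  qed
  \<comment> \<open>The lower left block is the adjoint of the upper right one, Q being
    self-adjoint.\<close>
  have T': "C * Q * hadj A + (D2 * hadj B2 + D3 * hadj B3) = D1 * hadj B1"
  proof -
    have "hadj (A * Q * hadj C + (B2 * hadj D2 + B3 * hadj D3)) = hadj (B1 * hadj D1)"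
      by (simp only: T(2))
    moreover have "hadj Q = Q" using Q(2) by (simp add: psd_iff)
    ultimately show ?thesis using d by (simp add: hadj_add hadj_mult mult_assoc_dims)
  qed
  note stein = gramian_difference_stein[OF dims(1) decay dims(3-5), folded Q_def]
  define M where "M = four_block_mat \<Upsilon> B1 (0\<^sub>m m n) D1"
  define N where "N = four_block_mat (A * \<Upsilon>) (hcat B2 B3) (C * \<Upsilon>) (hcat D2 D3)"
  define W where "W = four_block_mat Y (0\<^sub>m n m) (0\<^sub>m m n) (1\<^sub>m m)"
  have hc: "hcat B2 B3 \<in> carrier_mat n (q + r)" "hcat D2 D3 \<in> carrier_mat m (q + r)"
    using dims by (auto intro: hcat_carrier)
  have hM: "hadj M = four_block_mat \<Upsilon> (0\<^sub>m n m) (hadj B1) (hadj D1)"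
    unfolding M_def using dims \<Upsilon> by (subst hadj_four_block_mat[of _ n n _ p _ m]) auto
  have hN: "hadj N = four_block_mat (\<Upsilon> * hadj A) (\<Upsilon> * hadj C) (hadj (hcat B2 B3)) (hadj (hcat D2 D3))"
    unfolding N_def
    by (subst hadj_four_block_mat[of _ n n _ "q + r" _ m]) (simp_all add: hadj_mult hc d \<Upsilon>(2) carrier_matI)
  have Mc: "M \<in> carrier_mat (n + m) (n + p)" and Nc: "N \<in> carrier_mat (n + m) (n + (q + r))"
    and Wc: "W \<in> carrier_mat (n + m) (n + m)"
    by (intro carrier_matI; simp add: M_def N_def W_def d)+
  have hW: "hadj W = W"
    unfolding W_def using Y by (subst hadj_four_block_mat[of _ n n _ m _ m]) auto
  \<comment> \<open>Along v = (v1, v2) the form splits into that of Y at v1 and the squared norm of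
    v2. Both are nonnegative, so each vanishes, and observability disposes of v1.\<close>
  have definite: "v = 0\<^sub>v (n + m)" if v: "v \<in> carrier_vec (n + m)" "ip v (W *\<^sub>v v) = 0" for v
  proof -
    define v1 where "v1 = vec_first v n"
    define v2 where "v2 = vec_last v m"
    have v12: "v = v1 @\<^sub>v v2" "v1 \<in> carrier_vec n" "v2 \<in> carrier_vec m"
      using v(1) by (simp_all add: v1_def v2_def)
    have Wv: "W *\<^sub>v v = (Y *\<^sub>v v1) @\<^sub>v v2"
      unfolding W_def v12(1) using Y(1) v12(2,3) by (subst mult_mat_vec_split) auto
    have "ip v (W *\<^sub>v v) = ip v1 (Y *\<^sub>v v1) + ip v2 v2"
      unfolding Wv unfolding v12(1) using v12(2,3) d by (intro ip_append) auto
    then have "Re (ip v1 (Y *\<^sub>v v1)) + (vnorm v2)\<^sup>2 = 0" and e: "ip v1 (Y *\<^sub>v v1) + of_real ((vnorm v2)\<^sup>2) = 0"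
      using v(2) by (auto simp: ip_self dest: arg_cong[of _ _ Re])
    moreover have "psd Y"
      using ctrl_gram_psd[OF _ power_decay_hadj[OF dims(1) decay], of n "hadj C" m] dims
      by (simp add: Y_def obs_gram_eq_ctrl_gram[OF dims(1)])
    then have "0 \<le> Re (ip v1 (Y *\<^sub>v v1))" using v12(2) d by (auto simp: psd_iff)
    ultimately have "(vnorm v2)\<^sup>2 = 0" by (smt (verit) zero_le_power2)
    then have "v2 = 0\<^sub>v m" and "ip v1 (Y *\<^sub>v v1) = 0" using e v12(3) by (auto simp: vnorm_eq_0_iff)
    moreover from this have "v1 = 0\<^sub>v n"
      using obs_gram_definite[OF dims(1) decay dims(2) obs v12(2)] by (simp add: Y_def)
    ultimately show ?thesis unfolding v12(1) by (auto intro!: eq_vecI)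
  qed
  \<comment> \<open>With \<open>\<Upsilon> * \<Upsilon> = Q\<close> the blocks are, row by row,
    \<open>stein\<close>, \<open>T(2)\<close>, \<open>T'\<close> and \<open>T(1)\<close>.\<close>
  have NN: "N * hadj N = M * hadj M"
  proof -
    have "N * hadj N = four_block_mat (A * \<Upsilon> * (\<Upsilon> * hadj A) + hcat B2 B3 * hadj (hcat B2 B3))
        (A * \<Upsilon> * (\<Upsilon> * hadj C) + hcat B2 B3 * hadj (hcat D2 D3))
        (C * \<Upsilon> * (\<Upsilon> * hadj A) + hcat D2 D3 * hadj (hcat B2 B3))
        (C * \<Upsilon> * (\<Upsilon> * hadj C) + hcat D2 D3 * hadj (hcat D2 D3))"
      unfolding hN unfolding N_def
      by (intro mult_four_block_mat[of _ n n _ "q + r" _ m _ _ n _ m] carrier_matI) (simp_all add: d)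
    also have "\<dots> = four_block_mat (A * Q * hadj A + (B2 * hadj B2 + B3 * hadj B3))
        (A * Q * hadj C + (B2 * hadj D2 + B3 * hadj D3))
        (C * Q * hadj A + (D2 * hadj B2 + D3 * hadj B3))
        (C * Q * hadj C + (D2 * hadj D2 + D3 * hadj D3))"
      unfolding hcat_mult_hadj_hcat[OF dims(4) dims(4) dims(5) dims(5)] hcat_mult_hadj_hcat[OF dims(4) dims(7) dims(5) dims(8)]
        hcat_mult_hadj_hcat[OF dims(7) dims(4) dims(8) dims(5)] hcat_mult_hadj_hcat[OF dims(7) dims(7) dims(8) dims(8)]
        \<Upsilon>(3)[symmetric] by (simp add: mult_assoc_dims d)
    also have "\<dots> = four_block_mat (Q + B1 * hadj B1) (B1 * hadj D1) (D1 * hadj B1) (D1 * hadj D1)"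
      unfolding stein T T' ..
    also have "\<dots> = four_block_mat (\<Upsilon> * \<Upsilon> + B1 * hadj B1) (\<Upsilon> * 0\<^sub>m n m + B1 * hadj D1)
        (0\<^sub>m m n * \<Upsilon> + D1 * hadj B1) (0\<^sub>m m n * 0\<^sub>m n m + D1 * hadj D1)"
      by (simp add: \<Upsilon>(3) d)
    also have "\<dots> = M * hadj M"
      unfolding hM unfolding M_def
      by (intro mult_four_block_mat[of _ n n _ p _ m _ _ n _ m, symmetric] carrier_matI) (simp_all add: d)
    finally show ?thesis .
  qed
  \<comment> \<open>These repeat the two block matrices of the statement, to be recognised as
    \<open>hadj M * W * M\<close> and \<open>hadj M * W * N\<close>.\<close>
  define L where "L = four_block_mat (\<Upsilon> * Y * \<Upsilon>) (\<Upsilon> * Y * B1)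
      (hadj B1 * Y * \<Upsilon>) (hadj D1 * D1 + hadj B1 * Y * B1)"
  define R where "R = four_block_mat (\<Upsilon> * Y * A * \<Upsilon>) (hcat (\<Upsilon> * Y * B2) (\<Upsilon> * Y * B3))
      (hadj D1 * C * \<Upsilon> + hadj B1 * Y * A * \<Upsilon>)
      (hcat (hadj D1 * D2 + hadj B1 * Y * B2) (hadj D1 * D3 + hadj B1 * Y * B3))"
  have MW: "hadj M * W = four_block_mat (\<Upsilon> * Y) (0\<^sub>m n m) (hadj B1 * Y) (hadj D1)"
  proof -
    have "hadj M * W = four_block_mat (\<Upsilon> * Y + 0\<^sub>m n m * 0\<^sub>m m n) (\<Upsilon> * 0\<^sub>m n m + 0\<^sub>m n m * 1\<^sub>m m)
        (hadj B1 * Y + hadj D1 * 0\<^sub>m m n) (hadj B1 * 0\<^sub>m n m + hadj D1 * 1\<^sub>m m)"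
      unfolding hM W_def
      by (intro mult_four_block_mat[of _ n n _ m _ p _ _ n _ m] carrier_matI) (simp_all add: d)
    also have "\<dots> = four_block_mat (\<Upsilon> * Y) (0\<^sub>m n m) (hadj B1 * Y) (hadj D1)"
      by (simp add: d)
    finally show ?thesis .
  qed
  have L: "hadj M * W * M = L"
  proof -
    have "hadj M * W * M = four_block_mat (\<Upsilon> * Y * \<Upsilon> + 0\<^sub>m n m * 0\<^sub>m m n) (\<Upsilon> * Y * B1 + 0\<^sub>m n m * D1)
        (hadj B1 * Y * \<Upsilon> + hadj D1 * 0\<^sub>m m n) (hadj B1 * Y * B1 + hadj D1 * D1)"
      unfolding MW unfolding M_def
      by (intro mult_four_block_mat[of _ n n _ m _ p _ _ n _ p] carrier_matI) (simp_all add: d)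
    also have "hadj B1 * Y * B1 + hadj D1 * D1 = hadj D1 * D1 + hadj B1 * Y * B1"
      by (intro comm_add_mat[of _ p p] carrier_matI) (simp_all add: d)
    finally show ?thesis unfolding L_def by (simp add: d)
  qed
  have R: "hadj M * W * N = R"
  proof -
    have "hadj M * W * N = four_block_mat (\<Upsilon> * Y * (A * \<Upsilon>) + 0\<^sub>m n m * (C * \<Upsilon>)) (\<Upsilon> * Y * hcat B2 B3 + 0\<^sub>m n m * hcat D2 D3)
        (hadj B1 * Y * (A * \<Upsilon>) + hadj D1 * (C * \<Upsilon>)) (hadj B1 * Y * hcat B2 B3 + hadj D1 * hcat D2 D3)"
      unfolding MW N_def
      by (intro mult_four_block_mat[of _ n n _ m _ p _ _ n _ "q + r"] carrier_matI) (simp_all add: d)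
    also have "\<dots> = R"
      unfolding R_def
    proof (rule cong_four_block_mat)
      show "\<Upsilon> * Y * (A * \<Upsilon>) + 0\<^sub>m n m * (C * \<Upsilon>) = \<Upsilon> * Y * A * \<Upsilon>"
        by (simp add: mult_assoc_dims d)
      show "\<Upsilon> * Y * hcat B2 B3 + 0\<^sub>m n m * hcat D2 D3 = hcat (\<Upsilon> * Y * B2) (\<Upsilon> * Y * B3)"
        by (simp add: mult_hcat add_hcat d)
      show "hadj B1 * Y * (A * \<Upsilon>) + hadj D1 * (C * \<Upsilon>) = hadj D1 * C * \<Upsilon> + hadj B1 * Y * A * \<Upsilon>"
        by (simp add: mult_assoc_dims d, intro comm_add_mat[of _ p n] carrier_matI) (simp_all add: d)
      have "hadj B1 * Y * hcat B2 B3 + hadj D1 * hcat D2 D3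
        = hcat (hadj B1 * Y * B2 + hadj D1 * D2) (hadj B1 * Y * B3 + hadj D1 * D3)"
        by (simp add: mult_hcat add_hcat d)
      also have "hadj B1 * Y * B2 + hadj D1 * D2 = hadj D1 * D2 + hadj B1 * Y * B2"
        by (intro comm_add_mat[of _ p q] carrier_matI) (simp_all add: d)
      also have "hadj B1 * Y * B3 + hadj D1 * D3 = hadj D1 * D3 + hadj B1 * Y * B3"
        by (intro comm_add_mat[of _ p r] carrier_matI) (simp_all add: d)
      finally show "hadj B1 * Y * hcat B2 B3 + hadj D1 * hcat D2 D3
        = hcat (hadj D1 * D2 + hadj B1 * Y * B2) (hadj D1 * D3 + hadj B1 * Y * B3)" .
    qed
    finally show ?thesis .
  qed
  define U where "U = mp_inv L * R"
  have iso: "U \<in> carrier_mat (n + p) (n + (q + r))" "M * U = N" "partial_isometry U"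
    unfolding U_def L[symmetric] R[symmetric]
    by (rule weighted_least_squares_partial_isometry[OF Mc Nc Wc hW _ NN], erule (1) definite)+
  define \<alpha> \<beta>1 \<beta>2 where "\<alpha> = blk U 0 0 n n" and "\<beta>1 = blk U 0 n n q" and "\<beta>2 = blk U 0 (n + q) n r"
  define \<gamma> \<delta>1 \<delta>2 where "\<gamma> = blk U n 0 p n" and "\<delta>1 = blk U n n p q" and "\<delta>2 = blk U n (n + q) p r"
  have bc: "\<alpha> \<in> carrier_mat n n" "\<beta>1 \<in> carrier_mat n q" "\<beta>2 \<in> carrier_mat n r"
    "\<gamma> \<in> carrier_mat p n" "\<delta>1 \<in> carrier_mat p q" "\<delta>2 \<in> carrier_mat p r"
    by (simp_all add: \<alpha>_def \<beta>1_def \<beta>2_def \<gamma>_def \<delta>1_def \<delta>2_def)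
  have Ublk: "U = four_block_mat \<alpha> (hcat \<beta>1 \<beta>2) \<gamma> (hcat \<delta>1 \<delta>2)"
    unfolding \<alpha>_def \<beta>1_def \<beta>2_def \<gamma>_def \<delta>1_def \<delta>2_def by (rule four_block_mat_blk[OF iso(1)])
  have bd: "dim_row \<alpha> = n" "dim_col \<alpha> = n" "dim_row \<beta>1 = n" "dim_col \<beta>1 = q" "dim_row \<beta>2 = n" "dim_col \<beta>2 = r"
    "dim_row \<gamma> = p" "dim_col \<gamma> = n" "dim_row \<delta>1 = p" "dim_col \<delta>1 = q" "dim_row \<delta>2 = p" "dim_col \<delta>2 = r"
    using bc by auto
  have "M * U = four_block_mat (\<Upsilon> * \<alpha> + B1 * \<gamma>) (\<Upsilon> * hcat \<beta>1 \<beta>2 + B1 * hcat \<delta>1 \<delta>2)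
      (0\<^sub>m m n * \<alpha> + D1 * \<gamma>) (0\<^sub>m m n * hcat \<beta>1 \<beta>2 + D1 * hcat \<delta>1 \<delta>2)"
    unfolding Ublk M_def
    by (intro mult_four_block_mat[of _ n n _ p _ m _ _ n _ "q + r"] carrier_matI) (simp_all add: d bd)
  also have "\<dots> = four_block_mat (\<Upsilon> * \<alpha> + B1 * \<gamma>) (hcat (\<Upsilon> * \<beta>1 + B1 * \<delta>1) (\<Upsilon> * \<beta>2 + B1 * \<delta>2))
      (D1 * \<gamma>) (hcat (D1 * \<delta>1) (D1 * \<delta>2))"
    by (simp add: mult_hcat add_hcat d bd)
  finally have "four_block_mat (\<Upsilon> * \<alpha> + B1 * \<gamma>) (hcat (\<Upsilon> * \<beta>1 + B1 * \<delta>1) (\<Upsilon> * \<beta>2 + B1 * \<delta>2))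
      (D1 * \<gamma>) (hcat (D1 * \<delta>1) (D1 * \<delta>2)) = four_block_mat (A * \<Upsilon>) (hcat B2 B3) (C * \<Upsilon>) (hcat D2 D3)"
    using iso(2) by (simp only: N_def)
  note block_eq = this
  have cc: "\<Upsilon> * \<alpha> + B1 * \<gamma> \<in> carrier_mat n n" "D1 * \<gamma> \<in> carrier_mat m n"
    "\<Upsilon> * \<beta>1 + B1 * \<delta>1 \<in> carrier_mat n q" "\<Upsilon> * \<beta>2 + B1 * \<delta>2 \<in> carrier_mat n r"
    "D1 * \<delta>1 \<in> carrier_mat m q" "D1 * \<delta>2 \<in> carrier_mat m r"
    "A * \<Upsilon> \<in> carrier_mat n n" "C * \<Upsilon> \<in> carrier_mat m n"
    by (intro carrier_matI; simp add: d bd)+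
  \<comment> \<open>Comparison of blocks: the first block column gives the state equation and
    \<open>D1 * \<gamma> = C * \<Upsilon>\<close>, shared by both claims; the other block columns
    give the input equations for K and for F.\<close>
  note inj = four_block_mat_inject[OF block_eq cc(1) hcat_carrier[OF cc(3,4)] cc(2) hcat_carrier[OF cc(5,6)]
      cc(7) hc(1) cc(8) hc(2)]
  note e = inj(1,3)
  note e2 = hcat_inject[OF inj(2) cc(3) dims(4) cc(4) dims(5)]
  note e3 = hcat_inject[OF inj(4) cc(5) dims(7) cc(6) dims(8)]
  note contr = partial_isometry_block_contraction[OF bc iso(3)[unfolded Ublk]]
  \<comment> \<open>The F input is set to zero, which leaves the energy inequality for the K
    columns; the next claim exchanges the roles.\<close>
  have contr1: "\<forall>x \<in> carrier_vec n. \<forall>u \<in> carrier_vec q.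
      (vnorm (\<alpha> *\<^sub>v x + \<beta>1 *\<^sub>v u))\<^sup>2 + (vnorm (\<gamma> *\<^sub>v x + \<delta>1 *\<^sub>v u))\<^sup>2 \<le> (vnorm x)\<^sup>2 + (vnorm u)\<^sup>2"
  proof (intro ballI)
    fix x u :: "complex vec" assume xu: "x \<in> carrier_vec n" "u \<in> carrier_vec q"
    have "\<beta>1 *\<^sub>v u + \<beta>2 *\<^sub>v 0\<^sub>v r = \<beta>1 *\<^sub>v u" "\<delta>1 *\<^sub>v u + \<delta>2 *\<^sub>v 0\<^sub>v r = \<delta>1 *\<^sub>v u"
      using bd by (auto simp: scalar_prod_def)
    then show "(vnorm (\<alpha> *\<^sub>v x + \<beta>1 *\<^sub>v u))\<^sup>2 + (vnorm (\<gamma> *\<^sub>v x + \<delta>1 *\<^sub>v u))\<^sup>2 \<le> (vnorm x)\<^sup>2 + (vnorm u)\<^sup>2"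
      using contr[OF xu zero_carrier_vec] by simp
  qed
  have contr2: "\<forall>x \<in> carrier_vec n. \<forall>u \<in> carrier_vec r.
      (vnorm (\<alpha> *\<^sub>v x + \<beta>2 *\<^sub>v u))\<^sup>2 + (vnorm (\<gamma> *\<^sub>v x + \<delta>2 *\<^sub>v u))\<^sup>2 \<le> (vnorm x)\<^sup>2 + (vnorm u)\<^sup>2"
  proof (intro ballI)
    fix x u :: "complex vec" assume xu: "x \<in> carrier_vec n" "u \<in> carrier_vec r"
    have "\<beta>1 *\<^sub>v 0\<^sub>v q + \<beta>2 *\<^sub>v u = \<beta>2 *\<^sub>v u" "\<delta>1 *\<^sub>v 0\<^sub>v q + \<delta>2 *\<^sub>v u = \<delta>2 *\<^sub>v u"
      using bd by (auto simp: scalar_prod_def)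
    then show "(vnorm (\<alpha> *\<^sub>v x + \<beta>2 *\<^sub>v u))\<^sup>2 + (vnorm (\<gamma> *\<^sub>v x + \<delta>2 *\<^sub>v u))\<^sup>2 \<le> (vnorm x)\<^sup>2 + (vnorm u)\<^sup>2"
      using contr[OF xu(1) zero_carrier_vec xu(2)] by simp
  qed
  have X: "\<exists>X. stable_extension p q X \<alpha> (tf \<delta>1 \<gamma> \<alpha> \<beta>1)
      \<and> (\<forall>z \<in> ball 0 1. tf D1 C A B1 z * X z = tf D2 C A B2 z)
      \<and> (\<forall>z \<in> ball 0 1. op_norm (X z) \<le> 1)"
    by (rule contractive_solution[OF dims(1,2,3,6,4,7) \<Upsilon>(1) bc(1,2,4,5) decay e(1) e2(1) e(2) e3(1) contr1])
  have \<Psi>: "\<exists>\<Psi>. stable_extension p r \<Psi> \<alpha> (tf \<delta>2 \<gamma> \<alpha> \<beta>2)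
      \<and> (\<forall>z \<in> ball 0 1. tf D1 C A B1 z * \<Psi> z = tf D3 C A B3 z)
      \<and> (\<forall>z \<in> ball 0 1. op_norm (\<Psi> z) \<le> 1)"
    by (rule contractive_solution[OF dims(1,2,3,6,5,8) \<Upsilon>(1) bc(1,3,4,6) decay e(1) e2(2) e(2) e3(2) contr2])
  \<comment> \<open>The abbreviations are folded back in the order of their dependence, since each
    later one is stated in terms of the earlier.\<close>
  show ?thesis
    unfolding Let_def
    unfolding Q_def[symmetric] unfolding Y_def[symmetric] \<Upsilon>_def[symmetric]
    unfolding L_def[symmetric] R_def[symmetric] unfolding U_def[symmetric]
    unfolding \<alpha>_def[symmetric] \<beta>1_def[symmetric] \<beta>2_def[symmetric] \<gamma>_def[symmetric] \<delta>1_def[symmetric] \<delta>2_def[symmetric]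
    using iso(3) X \<Psi> by blast
qed

end
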